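(* Let $t,b,k$ be positive integers with $3 \le k \le t$ such that $\ell = bk/(t(t-1))$ is an integer. Under model $(\mathcal{M}1)$, a circular neighbor-balanced design $d^*\in\Omega_{(t,b,k)}$ is universally optimal for the vector of total effects $\phi=\tau+\lambda$ over the class of all designs $d\in\Omega_{(t,b,k)}$ in which no treatment is a neighbor of itself, i.e. $d(i,j)\neq d(i,j-1)$ for all $1\le i\le b$, $1\le j\le k$. That is, $\Phi(C_{d^*}[\phi])\le \Phi(C_d[\phi])$ for every such $d$ and every criterion $\Phi$ in Kiefer's class.
   Context: Designs: there are $t$ treatments labelled $1,\dots,t$ and $b$ linear blocks. Block $i$ has inner plots $j=1,\dots,k$ and two border plots $j=0$ and $j=k+1$. A design $d$ assigns a treatment $d(i,j)$ to each plot $(i,j)$, $0\le j\le k+1$. The design is circular if $d(i,0)=d(i,k)$ and $d(i,k+1)=d(i,1)$ for all $i$. $\Omega_{(t,b,k)}$ denotes the set of all circular designs with $t$ treatments and $b$ blocks of length $k$. Model $(\mathcal{M}1)$: responses $Y_{i,j}$ ($1\le i\le b$, $1\le j\le k$, border plots are not observed) are uncorrelated with common variance and $\mathbb{E}(Y_{i,j})=\beta_i+\tau_{d(i,j)}+\lambda_{d(i,j-1)}$; in vector form $\mathbb{E}(Y)=B\beta+T_d\tau+L_d\lambda$, where $B$ ($bk\times b$) is the block incidence matrix and $T_d$, $L_d$ ($bk\times t$) have in row $(i,j)$ a single $1$ in column $d(i,j)$, resp. $d(i,j-1)$. The total effects are $\phi=\tau+\lambda=K'\alpha$ with $\alpha=(\tau',\lambda')'$,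 $K=\mathbf{1}_2\otimes I_t$. Information matrices: for a matrix $A$, $A^+$ is the Moore–Penrose inverse, $\mathrm{pr}_{(A)}=A(A'A)^+A'$ and $\mathrm{pr}_{(A)}^\perp=I-\mathrm{pr}_{(A)}$. In a model $\mathbb{E}(Y)=A\alpha+B\beta$ with uncorrelated homoscedastic errors, the information matrix for $\alpha$ is $C[\alpha]=A'\mathrm{pr}^\perp_{(B)}A$; for $K'\alpha$ it is $C[K'\alpha]=X_1'\mathrm{pr}^\perp_{(X_2)}X_1$ with $X_1=AK(K'K)^+$, $X_2=(AM\mid B)$, $M=I-K(K'K)^+K'$ (the information for $\theta_1=K'\alpha$ in the reparametrized model $\mathbb{E}(Y)=X_1\theta_1+AM(M\alpha)+B\beta$). $C_d[\phi]$ is this matrix with $A=(T_d\mid L_d)$. Circular neighbor-balanced design (CNBD): a design in $\Omega_{(t,b,k)}$ which is binary (each treatment occurs at most once among the inner plots of each block), is a balanced block design (each treatment occurs on the same number of inner plots and each unordered pair of distinct treatments occurs together in the inner plots of the same number of blocks), and such that for each ordered pair $(a,c)$ of distinct treatments there are exactly $\ell$ inner plots $(i,j)$ with $d(i,j)=a$ and $d(i,j+1)=c$. Universal optimality (Kiefer): $d^*$ is universally optimal over a class $\mathcal{D}$ if $\Phi(C_{d^*})\le\Phi(C_d)$ for all $d\in\mathcal{D}$ and every function $\Phi$ from nonnegative definite symmetric $t\times t$ matrices to $(-\infty,\infty]$ that is convex, satisfies that $\Phi(aC)$ is nonincreasing in the scalar $a\ge0$, and is invariant under simultaneous permutation of rows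 and columns. *)

theory Defs
  imports "Jordan_Normal_Form.Matrix" "HOL-Library.Extended_Real" "HOL-Combinatorics.Permutations"
begin

definition mp_inverse :: "real mat \<Rightarrow> real mat" where
  "mp_inverse A = (THE X. X \<in> carrier_mat (dim_col A) (dim_row A) \<and>
       A * X * A = A \<and> X * A * X = X \<and>
       transpose_mat (A * X) = A * X \<and> transpose_mat (X * A) = X * A)"

definition proj_mat :: "real mat \<Rightarrow> real mat" where
  "proj_mat A = A * mp_inverse (transpose_mat A * A) * transpose_mat A"

definition proj_perp :: "real mat \<Rightarrow> real mat" where
  "proj_perp A = 1\<^sub>m (dim_row A) - proj_mat A"

definition hcat :: "real mat \<Rightarrow> real mat \<Rightarrow> real mat" where
  "hcat P Q = mat (dim_row P) (dim_col P + dim_col Q)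
     (\<lambda>(r, c). if c < dim_col P then P $$ (r, c) else Q $$ (r, c - dim_col P))"

text \<open>Information matrix for K'alpha in the model E(Y) = A alpha + B beta:
  X1' pr^perp_(X2) X1, with X1 = A K (K'K)^+, X2 = (A M | B), M = I - K (K'K)^+ K'.\<close>
definition info_mat_lin :: "real mat \<Rightarrow> real mat \<Rightarrow> real mat \<Rightarrow> real mat" where
  "info_mat_lin A B K =
     (let X1 = A * K * mp_inverse (transpose_mat K * K);
          M = 1\<^sub>m (dim_row K) - K * mp_inverse (transpose_mat K * K) * transpose_mat K;
          X2 = hcat (A * M) B
      in transpose_mat X1 * proj_perp X2 * X1)"

text \<open>A design is a function d :: nat => nat => nat; d i j is the treatment on plot (i,j),
  blocks i = 1..b, plots j = 0..k+1 (0 and k+1 border plots), treatments 1..t.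
  Values outside this index range are irrelevant.\<close>

definition circular_design :: "nat \<Rightarrow> nat \<Rightarrow> nat \<Rightarrow> (nat \<Rightarrow> nat \<Rightarrow> nat) \<Rightarrow> bool" where
  "circular_design t b k d \<longleftrightarrow>
     (\<forall>i\<in>{1..b}. \<forall>j\<in>{0..k+1}. d i j \<in> {1..t}) \<and>
     (\<forall>i\<in>{1..b}. d i 0 = d i k \<and> d i (k+1) = d i 1)"

text \<open>Observations (i,j), 1 <= i <= b, 1 <= j <= k, are ordered lexicographically:
  row index (i-1)*k + (j-1).  Treatment a corresponds to column a-1.\<close>

definition block_mat :: "nat \<Rightarrow> nat \<Rightarrow> real mat" where
  "block_mat b k = mat (b * k) b (\<lambda>(r, c). if r div k = c then 1 else 0)"

definition treat_mat :: "nat \<Rightarrow> nat \<Rightarrow> nat \<Rightarrow> (nat \<Rightarrow> nat \<Rightarrow> nat) \<Rightarrow> real mat" where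
  "treat_mat t b k d = mat (b * k) t
     (\<lambda>(r, c). if d (r div k + 1) (r mod k + 1) = c + 1 then 1 else 0)"

definition left_mat :: "nat \<Rightarrow> nat \<Rightarrow> nat \<Rightarrow> (nat \<Rightarrow> nat \<Rightarrow> nat) \<Rightarrow> real mat" where
  "left_mat t b k d = mat (b * k) t
     (\<lambda>(r, c). if d (r div k + 1) (r mod k) = c + 1 then 1 else 0)"

text \<open>K = 1_2 (Kronecker) I_t, a (2t) x t matrix.\<close>
definition K_mat :: "nat \<Rightarrow> real mat" where
  "K_mat t = mat (2 * t) t (\<lambda>(r, c). if r mod t = c then 1 else 0)"

text \<open>C_d[phi] under model (M1), phi = tau + lambda = K' alpha.\<close>
definition info_total :: "nat \<Rightarrow> nat \<Rightarrow> nat \<Rightarrow> (nat \<Rightarrow> nat \<Rightarrow> nat) \<Rightarrow> real mat" where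
  "info_total t b k d =
     info_mat_lin (hcat (treat_mat t b k d) (left_mat t b k d)) (block_mat b k) (K_mat t)"

definition binary_design :: "nat \<Rightarrow> nat \<Rightarrow> (nat \<Rightarrow> nat \<Rightarrow> nat) \<Rightarrow> bool" where
  "binary_design b k d \<longleftrightarrow>
     (\<forall>i\<in>{1..b}. \<forall>j1\<in>{1..k}. \<forall>j2\<in>{1..k}. d i j1 = d i j2 \<longrightarrow> j1 = j2)"

definition balanced_block_design :: "nat \<Rightarrow> nat \<Rightarrow> nat \<Rightarrow> (nat \<Rightarrow> nat \<Rightarrow> nat) \<Rightarrow> bool" where
  "balanced_block_design t b k d \<longleftrightarrow>
     (\<exists>r. \<forall>a\<in>{1..t}. card {(i, j). i \<in> {1..b} \<and> j \<in> {1..k} \<and> d i j = a} = r) \<and>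
     (\<exists>\<mu>. \<forall>a\<in>{1..t}. \<forall>c\<in>{1..t}. a \<noteq> c \<longrightarrow>
         card {i \<in> {1..b}. a \<in> d i ` {1..k} \<and> c \<in> d i ` {1..k}} = \<mu>)"

definition CNBD :: "nat \<Rightarrow> nat \<Rightarrow> nat \<Rightarrow> nat \<Rightarrow> (nat \<Rightarrow> nat \<Rightarrow> nat) \<Rightarrow> bool" where
  "CNBD t b k l d \<longleftrightarrow>
     circular_design t b k d \<and> binary_design b k d \<and> balanced_block_design t b k d \<and>
     (\<forall>a\<in>{1..t}. \<forall>c\<in>{1..t}. a \<noteq> c \<longrightarrow>
        card {(i, j). i \<in> {1..b} \<and> j \<in> {1..k} \<and> d i j = a \<and> d i (j + 1) = c} = l)"

definition no_self_neighbor :: "nat \<Rightarrow> nat \<Rightarrow> (nat \<Rightarrow> nat \<Rightarrow> nat) \<Rightarrow> bool" where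
  "no_self_neighbor b k d \<longleftrightarrow> (\<forall>i\<in>{1..b}. \<forall>j\<in>{1..k}. d i j \<noteq> d i (j - 1))"

definition nnd_sym :: "nat \<Rightarrow> real mat \<Rightarrow> bool" where
  "nnd_sym t C \<longleftrightarrow> C \<in> carrier_mat t t \<and> transpose_mat C = C \<and>
     (\<forall>v \<in> carrier_vec t. 0 \<le> v \<bullet> (C *\<^sub>v v))"

text \<open>Phi maps nonnegative definite symmetric t x t matrices to (-infinity, infinity];
  its values elsewhere are irrelevant.\<close>
definition kiefer_criterion :: "nat \<Rightarrow> (real mat \<Rightarrow> ereal) \<Rightarrow> bool" where
  "kiefer_criterion t \<Phi> \<longleftrightarrow>
     (\<forall>C. nnd_sym t C \<longrightarrow> \<Phi> C \<noteq> -\<infinity>) \<and>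
     (\<forall>C D (x::real). nnd_sym t C \<longrightarrow> nnd_sym t D \<longrightarrow> 0 < x \<longrightarrow> x < 1 \<longrightarrow>
        \<Phi> (x \<cdot>\<^sub>m C + (1 - x) \<cdot>\<^sub>m D) \<le> ereal x * \<Phi> C + ereal (1 - x) * \<Phi> D) \<and>
     (\<forall>C (a::real) a'. nnd_sym t C \<longrightarrow> 0 \<le> a \<longrightarrow> a \<le> a' \<longrightarrow>
        \<Phi> (a' \<cdot>\<^sub>m C) \<le> \<Phi> (a \<cdot>\<^sub>m C)) \<and>
     (\<forall>C \<sigma>. nnd_sym t C \<longrightarrow> \<sigma> permutes {..<t} \<longrightarrow>
        \<Phi> (mat t t (\<lambda>(i, j). C $$ (\<sigma> i, \<sigma> j))) = \<Phi> C)"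

definition universally_optimal ::
  "nat \<Rightarrow> ((nat \<Rightarrow> nat \<Rightarrow> nat) \<Rightarrow> real mat) \<Rightarrow> ((nat \<Rightarrow> nat \<Rightarrow> nat) \<Rightarrow> bool) \<Rightarrow>
   (nat \<Rightarrow> nat \<Rightarrow> nat) \<Rightarrow> bool" where
  "universally_optimal t C DD d0 \<longleftrightarrow>
     (\<forall>\<Phi> d. kiefer_criterion t \<Phi> \<longrightarrow> DD d \<longrightarrow> \<Phi> (C d0) \<le> \<Phi> (C d))"

end

theory Submission
  imports Defs
begin

text \<open>Write Y for the matrix T + L centred within blocks. Projecting further onto the column space of
  (T - L | B) can only decrease the information, so C_d = (Y'Y - Z'Z) / 4 with Z the projection of Y,
  whose trace is at most that of Y'Y / 4. Without self neighbours this trace is bk/2 - S/k, where S is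
  the sum of the squared treatment replications within blocks; S is at least bk, with equality for
  binary designs. For a CNBD the matrix T'L is symmetric (here circularity enters), so Y is orthogonal
  to T - L, Z vanishes and C_d attains the bound; balance makes it a multiple of the centring matrix.
  Averaging an arbitrary C_d over all simultaneous permutations gives the multiple of the centring matrix
  with the same trace, and convexity and monotonicity of the criterion finish the argument.\<close>

subsection \<open>Moore-Penrose inverses and projections\<close>

text \<open>A Kiefer criterion is required to be monotone only along rays, not in the Loewner order,
  so the matrix bound Y'Y/4 cannot be inserted into it; what survives the averaging is the trace.
  For the average to lie on the ray of the centring matrix, the row sums of C_d must vanish: C_d has
  Y as its right factor, and each row of Y sums to 1 + 1 - 2k/k = 0. Self neighbours are excluded
  because each of them adds 2 to tr Y'Y. The bound on S is n^2 >= n for integer replications n,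
  which makes the largest trace b(k-2)/2. The factor 1/4 comes from K'K = 2I, whose inverse enters
  on both sides. Information matrices are built on a definite description of the Moore-Penrose
  inverse, so its existence has to be established before any of them can be evaluated. Symmetric
  matrices suffice, since the inverse is only ever taken of Gram matrices.\<close>

declare assoc_mult_mat [simp del]

text \<open>The diagonal of the Gram matrix holds the squared norms of the columns. This
  definiteness serves below to show that residuals vanish.\<close>

lemma gram_eq_0_iff:
  fixes Y :: "real mat"
  assumes "transpose_mat Y * Y = 0\<^sub>m (dim_col Y) (dim_col Y)"
  shows "Y = 0\<^sub>m (dim_row Y) (dim_col Y)"
proof (rule eq_matI)
  fix i j assume ij: "i < dim_row (0\<^sub>m (dim_row Y) (dim_col Y))" "j < dim_col (0\<^sub>m (dim_row Y) (dim_col Y))"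
  have "(transpose_mat Y * Y) $$ (j, j) = (\<Sum>i<dim_row Y. (Y $$ (i, j))\<^sup>2)"
    using ij by (simp add: scalar_prod_def power2_eq_square atLeast0LessThan)
  then have "(\<Sum>i<dim_row Y. (Y $$ (i, j))\<^sup>2) = 0"
    using assms ij by simp
  then show "Y $$ (i, j) = 0\<^sub>m (dim_row Y) (dim_col Y) $$ (i, j)"
    using ij by (simp add: sum_nonneg_eq_0_iff)
qed simp_all

lemma minus_eq_0_mat:
  fixes X :: "'a :: group_add mat"
  assumes "X \<in> carrier_mat n m" "Y \<in> carrier_mat n m" "X - Y = 0\<^sub>m n m"
  shows "X = Y"
proof (rule eq_matI)
  fix i j assume ij: "i < dim_row Y" "j < dim_col Y"
  then have "(X - Y) $$ (i, j) = X $$ (i, j) - Y $$ (i, j)" by simp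
  then show "X $$ (i, j) = Y $$ (i, j)" using ij assms by simp
qed (use assms in auto)

text \<open>If A W projects orthogonally onto a subspace of the column space of A, a rank one correction of W
  enlarges that subspace by A e. Adding all columns of A this way yields a {1,3}-inverse of A; for symmetric A
  the Moore-Penrose inverse is then W' A W.\<close>

lemma gram_schmidt_step:
  fixes A W :: "real mat"
  assumes A: "A \<in> carrier_mat n m" and W: "W \<in> carrier_mat m n"
    and sym: "transpose_mat (A * W) = A * W" and idem: "A * W * (A * W) = A * W"
    and e: "e \<in> carrier_mat m 1"
  obtains W' where "W' \<in> carrier_mat m n"
    "transpose_mat (A * W') = A * W'" "A * W' * (A * W') = A * W'"
    "A * W' * (A * e) = A * e"
    "\<And>f. f \<in> carrier_mat m 1 \<Longrightarrow> A * W * (A * f) = A * f \<Longrightarrow> A * W' * (A * f) = A * f"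
proof -
  define P where "P = A * W"
  define a where "a = A * e"
  \<comment> \<open>\<open>A * z\<close> is the residual of \<open>A * e\<close> off the range of
    \<open>P\<close>. Keeping the preimage \<open>z\<close> lets the correction of the projector be
    written as a correction of \<open>W\<close>.\<close>
  define z where "z = e - W * a"
  define u where "u = A * z"
  have P: "P \<in> carrier_mat n n" and a: "a \<in> carrier_mat n 1" and z: "z \<in> carrier_mat m 1"
    and u: "u \<in> carrier_mat n 1" and ut: "transpose_mat u \<in> carrier_mat 1 n"
    using A W e by (auto simp: P_def a_def z_def u_def)
  have u_eq: "u = a - P * a"
    proof -
    have "A * (W * a) = P * a" using assoc_mult_mat[OF A W a] by (simp add: P_def)
    then show ?thesis
      using mult_minus_distrib_mat[OF A e, of "W * a"] W a by (simp add: u_def z_def a_def)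
  qed
  have Pu: "P * u = 0\<^sub>m n 1"
  proof -
    have "P * u = P * a - P * (P * a)"
      using P a by (simp add: u_eq mult_minus_distrib_mat)
    also have "P * (P * a) = P * a"
      using idem P a by (simp flip: assoc_mult_mat P_def)
    finally show ?thesis using P a by auto
  qed
  have uP: "transpose_mat u * P = 0\<^sub>m 1 n"
    using arg_cong[OF Pu, of transpose_mat] sym P u by (simp add: transpose_mult P_def)
  \<comment> \<open>Vectors fixed by \<open>P\<close> are orthogonal to \<open>u\<close>, so columns
    captured earlier stay fixed after the correction.\<close>
  have uf: "transpose_mat u * g = 0\<^sub>m 1 1" if "P * g = g" "g \<in> carrier_mat n 1" for g
  proof -
    have "transpose_mat u * g = transpose_mat u * (P * g)" using that by simp
    also have "\<dots> = transpose_mat u * P * g" using assoc_mult_mat[OF ut P that(2)] by simp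
    finally show ?thesis using that by (simp add: uP)
  qed
  have ua: "transpose_mat u * a = transpose_mat u * u"
  proof -
    have "transpose_mat u * u = transpose_mat u * a - transpose_mat u * P * a"
      using ut P a by (subst (2) u_eq) (simp add: mult_minus_distrib_mat assoc_mult_mat[OF ut P a])
    then show ?thesis using ut a by (simp add: uP) auto
  qed
  show thesis
  proof (cases "u = 0\<^sub>m n 1")
    case True
    have "P * a = a"
      by (rule minus_eq_0_mat[OF a, symmetric]) (use P a True in \<open>auto simp flip: u_eq\<close>)
    then show ?thesis using that[OF W sym idem] by (auto simp: P_def a_def)
  next
    case False
    define s where "s = (transpose_mat u * u) $$ (0, 0)"
    have uu: "transpose_mat u * u = s \<cdot>\<^sub>m 1\<^sub>m 1"
      using u by (intro eq_matI) (auto simp: s_def)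
    have s: "s \<noteq> 0"
    proof
      assume "s = 0"
      then have "transpose_mat u * u = 0\<^sub>m 1 1" by (simp add: uu) auto
      then show False using gram_eq_0_iff[of u] u False by auto
    qed
    \<comment> \<open>The orthogonal projector onto the line of \<open>u\<close>. Since
      \<open>P * u = 0\<close>, the cross products vanish and \<open>P + R\<close> is again an
      orthogonal projector.\<close>
    define R where "R = (1 / s) \<cdot>\<^sub>m (u * transpose_mat u)"
    define W' where "W' = W + (1 / s) \<cdot>\<^sub>m (z * transpose_mat u)"
    have R: "R \<in> carrier_mat n n" using u by (simp add: R_def)
    have W': "W' \<in> carrier_mat m n" using W z u by (simp add: W'_def)
    have AW': "A * W' = P + R"
      using A W z u ut
      by (simp add: W'_def R_def P_def mult_add_distrib_mat[of _ n m _ n] mult_smult_distrib[of _ n m _ n]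
          u_def assoc_mult_mat[of _ n m _ 1 _ n])
    have Rg: "R * g = (1 / s) \<cdot>\<^sub>m (u * (transpose_mat u * g))" if "g \<in> carrier_mat n q" for g q
      using u ut that by (simp add: R_def mult_smult_assoc_mat[of _ n n _ q] assoc_mult_mat[of _ n 1 _ n _ q])
    have RR: "R * R = R"
    proof -
      have "transpose_mat u * R = transpose_mat u"
        using u ut uu s by (simp add: R_def mult_smult_distrib[of _ 1 n _ n]
            assoc_mult_mat[symmetric, of _ 1 n _ 1 _ n] mult_smult_assoc_mat[of _ 1 1 _ n]) auto
      then show ?thesis using Rg[OF R] by (simp add: R_def)
    qed
    have RP: "R * P = 0\<^sub>m n n"
      using Rg[OF P] uP u by auto
    have PR: "P * R = 0\<^sub>m n n"
      using P u ut Pu by (simp add: R_def mult_smult_distrib[of _ n n _ n] assoc_mult_mat[symmetric, of _ n n _ 1 _ n])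
    show ?thesis
    proof (rule that[OF W'])
      have Rs: "transpose_mat R = R" using u
        by (intro eq_matI) (auto simp: R_def scalar_prod_def)
      show "transpose_mat (A * W') = A * W'"
        using P R sym Rs by (simp add: AW' transpose_add P_def[symmetric])
      show "A * W' * (A * W') = A * W'"
        using P R RR PR RP idem
        by (simp add: AW' mult_add_distrib_mat[of _ n n _ n] add_mult_distrib_mat[of _ n n] P_def[symmetric])
      have "R * a = u"
        using Rg[OF a] ua uu u s by (simp add: mult_smult_distrib[of _ n 1 _ 1]) auto
      then have "A * W' * a = P * a + u"
        using P R a by (simp add: AW' add_mult_distrib_mat[of _ n n])
      also have "\<dots> = a"
        unfolding u_eq using P a by (intro eq_matI) auto
      finally show "A * W' * (A * e) = A * e" by (simp add: a_def)
      fix f :: "real mat" assume f: "f \<in> carrier_mat m 1" and "A * W * (A * f) = A * f"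
      then have Pf: "P * (A * f) = A * f" and Af: "A * f \<in> carrier_mat n 1"
        using A by (auto simp: P_def)
      have "R * (A * f) = 0\<^sub>m n 1"
        using Rg[OF Af] uf[OF Pf Af] u by auto
      then show "A * W' * (A * f) = A * f"
        using P R Af Pf by (simp add: AW' add_mult_distrib_mat[of _ n n])
    qed
  qed
qed

lemma ex_13_inverse:
  fixes A :: "real mat"
  assumes A: "A \<in> carrier_mat n m"
  obtains W where "W \<in> carrier_mat m n" "A * W * A = A" "transpose_mat (A * W) = A * W"
proof -
  \<comment> \<open>Unit vectors as one-column matrices: \<open>A * E j\<close> is column
    \<open>j\<close> of \<open>A\<close>.\<close>
  define E where "E j = (mat m 1 (\<lambda>(i, _). if i = j then 1 else 0) :: real mat)" for j
  have E: "E j \<in> carrier_mat m 1" for j by (auto simp: E_def intro!: carrier_matI)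
  have AE: "B * E j = mat n 1 (\<lambda>(i, _). B $$ (i, j))" if "j < m" "B \<in> carrier_mat n m" for B j
    using that by (intro eq_matI) (auto simp: E_def scalar_prod_def if_distrib[of "(*) _"] cong: if_cong)
  \<comment> \<open>Invariant after \<open>c\<close> columns: \<open>A * W\<close> is an orthogonal
    projector fixing these columns. It starts from \<open>W = 0\<close>.\<close>
  have "\<exists>W \<in> carrier_mat m n. transpose_mat (A * W) = A * W \<and> A * W * (A * W) = A * W \<and>
    (\<forall>j<c. A * W * (A * E j) = A * E j)" for c
  proof (induction c)
    case 0
    show ?case using A by (intro bexI[of _ "0\<^sub>m m n"]) auto
  next
    case (Suc c)
    then obtain W where W: "W \<in> carrier_mat m n" "transpose_mat (A * W) = A * W" "A * W * (A * W) = A * W"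
      and c: "\<forall>j<c. A * W * (A * E j) = A * E j" by blast
    show ?case
      by (rule gram_schmidt_step[OF A W E[of c]]) (use c E in \<open>auto simp: less_Suc_eq\<close>)
  qed
  then obtain W where W: "W \<in> carrier_mat m n" "transpose_mat (A * W) = A * W"
    and c: "\<forall>j<m. A * W * (A * E j) = A * E j" by blast
  have AWA: "A * W * A \<in> carrier_mat n m" using A W by auto
  have "A * W * A = A"
  proof (rule eq_matI)
    fix i j assume ij: "i < dim_row A" "j < dim_col A"
    have "A * W * A * E j = A * E j"
      using c ij A W E by (simp add: assoc_mult_mat[of _ n n _ m _ 1])
    then have "mat n 1 (\<lambda>(i, _). (A * W * A) $$ (i, j)) = mat n 1 (\<lambda>(i, _). A $$ (i, j))"
      using ij A AE[OF _ AWA] AE[OF _ A] by auto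
    then have "mat n 1 (\<lambda>(i, _). (A * W * A) $$ (i, j)) $$ (i, 0) = mat n 1 (\<lambda>(i, _). A $$ (i, j)) $$ (i, 0)"
      by simp
    then show "(A * W * A) $$ (i, j) = A $$ (i, j)"
      using ij A AWA by (simp del: index_mult_mat(1))
  qed (use A W in auto)
  then show thesis using that W by blast
qed

definition is_mp_inverse :: "real mat \<Rightarrow> real mat \<Rightarrow> bool" where
  "is_mp_inverse A X \<longleftrightarrow> X \<in> carrier_mat (dim_col A) (dim_row A) \<and>
       A * X * A = A \<and> X * A * X = X \<and>
       transpose_mat (A * X) = A * X \<and> transpose_mat (X * A) = X * A"

text \<open>Penrose's argument: \<open>A * X\<close> and \<open>A * Y\<close> are the same
  orthogonal projector, and so are \<open>X * A\<close> and \<open>Y * A\<close>; then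
  \<open>X = X * A * X\<close> can be rewritten factor by factor into
  \<open>Y * A * Y\<close>.\<close>

lemma is_mp_inverse_unique:
  assumes "is_mp_inverse A X" "is_mp_inverse A Y"
  shows "X = Y"
proof -
  obtain n m where A: "A \<in> carrier_mat n m" by blast
  have X: "X \<in> carrier_mat m n" "A * X * A = A" "X * A * X = X"
    "transpose_mat (A * X) = A * X" "transpose_mat (X * A) = X * A"
    using assms(1) A by (auto simp: is_mp_inverse_def)
  have Y: "Y \<in> carrier_mat m n" "A * Y * A = A" "Y * A * Y = Y"
    "transpose_mat (A * Y) = A * Y" "transpose_mat (Y * A) = Y * A"
    using assms(2) A by (auto simp: is_mp_inverse_def)
  have AXY: "A * X = A * Y"
  proof -
    have "A * X = transpose_mat (A * Y * A * X)" unfolding Y(2) X(4) ..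
    also have "\<dots> = transpose_mat ((A * Y) * (A * X))"
      using A X Y by (subst assoc_mult_mat[of _ n n _ m _ n]) auto
    also have "\<dots> = (A * X) * (A * Y)"
      using A X Y by (subst transpose_mult[of _ n n _ n]) auto
    also have "\<dots> = A * X * A * Y"
      using A X Y by (subst assoc_mult_mat[of _ n n _ m _ n]) auto
    finally show ?thesis unfolding X(2) .
  qed
  have XYA: "X * A = Y * A"
  proof -
    have "X * A = transpose_mat (X * (A * Y * A))" using X Y by simp
    also have "\<dots> = transpose_mat ((X * A) * (Y * A))"
      using A X Y by (simp add: assoc_mult_mat[of _ n m _ n _ m] assoc_mult_mat[of _ m n _ m _ m])
    also have "\<dots> = (Y * A) * (X * A)"
      using A X Y by (subst transpose_mult[of _ m m _ m]) auto
    also have "\<dots> = Y * (A * X * A)"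
      using A X Y by (simp add: assoc_mult_mat[of _ n m _ n _ m] assoc_mult_mat[of _ m n _ m _ m])
    finally show ?thesis using X by simp
  qed
  have "X = X * (A * X)" using A X by (simp flip: assoc_mult_mat[of _ m n _ m _ n])
  also have "\<dots> = Y * A * Y" using A X Y AXY XYA by (simp flip: assoc_mult_mat[of _ m n _ m _ n])
  finally show ?thesis using Y by simp
qed

lemma mp_inverse_eqI: "is_mp_inverse A X \<Longrightarrow> mp_inverse A = X"
  unfolding mp_inverse_def is_mp_inverse_def[symmetric]
  by (blast intro: is_mp_inverse_unique)

text \<open>For symmetric \<open>A\<close> the transpose of a {1,3}-inverse \<open>W\<close> is a
  {1,4}-inverse, and the product of the two around \<open>A\<close> satisfies all four Penrose
  conditions.\<close>

lemma is_mp_inverse_symmetric: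
  assumes A: "A \<in> carrier_mat n n" and sym: "transpose_mat A = A"
  shows "is_mp_inverse A (mp_inverse A)"
proof -
  obtain W where W: "W \<in> carrier_mat n n" and AWA: "A * W * A = A" and AW: "transpose_mat (A * W) = A * W"
    using ex_13_inverse[OF A] by blast
  define V where "V = transpose_mat W"
  have V: "V \<in> carrier_mat n n" using W by (simp add: V_def)
  have VA: "V * A = A * W" using AW A W sym by (simp add: V_def transpose_mult)
  note assoc = assoc_mult_mat[of _ n n _ n _ n]
  have AVA: "A * V * A = A"
    using arg_cong[OF AWA, of transpose_mat] A W V sym
    by (simp add: transpose_mult[of _ n n _ n] V_def assoc)
  have "is_mp_inverse A (V * A * W)"
    unfolding is_mp_inverse_def
  proof (intro conjI)
    have 1: "A * (V * A * W) = A * W"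
      using A V W by (simp add: AVA flip: assoc)
    have 2: "V * A * W * A = V * A"
      using A V W AWA by (simp add: assoc)
    show "A * (V * A * W) * A = A" by (simp add: 1 AWA)
    show "V * A * W * A * (V * A * W) = V * A * W"
      using A V W 2 AVA by (simp add: assoc)(simp flip: assoc)
    show "transpose_mat (A * (V * A * W)) = A * (V * A * W)" by (simp add: 1 AW)
    show "transpose_mat (V * A * W * A) = V * A * W * A" unfolding 2 by (simp add: VA AW)
    show "V * A * W \<in> carrier_mat (dim_col A) (dim_row A)" using A V W by (intro carrier_matI) auto
  qed
  then show ?thesis using mp_inverse_eqI by metis
qed

text \<open>For symmetric \<open>A\<close>, transposition permutes the Penrose conditions, so the
  transpose is a second Moore-Penrose inverse and uniqueness applies.\<close>

lemma transpose_mp_inverse: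
  assumes A: "A \<in> carrier_mat n n" and sym: "transpose_mat A = A"
  shows "transpose_mat (mp_inverse A) = mp_inverse A"
proof -
  define X where "X = mp_inverse A"
  have X: "X \<in> carrier_mat n n" "A * X * A = A" "X * A * X = X"
    "transpose_mat (A * X) = A * X" "transpose_mat (X * A) = X * A"
    using is_mp_inverse_symmetric[OF assms] A by (auto simp: is_mp_inverse_def X_def)
  note assoc = assoc_mult_mat[of _ n n _ n _ n]
  have 1: "A * transpose_mat X = X * A" and 2: "transpose_mat X * A = A * X"
    using X A sym by (simp_all add: transpose_mult[of _ n n _ n])
  have "A * (transpose_mat X * A) = A"
    using arg_cong[OF X(2), of transpose_mat] A X(1) sym
    by (subst (asm) transpose_mult[of _ n n _ n]; simp add: transpose_mult[of _ n n _ n])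
  then have 3: "X * A * A = A"
    using A X(1) by (simp flip: 1) (simp add: assoc)
  have "transpose_mat X * (A * transpose_mat X) = transpose_mat X"
    using arg_cong[OF X(3), of transpose_mat] A X(1) sym
    by (subst (asm) transpose_mult[of _ n n _ n]; simp add: transpose_mult[of _ n n _ n])
  then have 4: "A * X * transpose_mat X = transpose_mat X"
    using A X(1) by (simp flip: 2) (simp add: assoc)
  have "is_mp_inverse A (transpose_mat X)"
    using A X sym by (simp add: is_mp_inverse_def 1 2 3 4)
  then show ?thesis using mp_inverse_eqI X_def by metis
qed

lemma
  fixes X :: "real mat"
  assumes X: "X \<in> carrier_mat n m"
  shows proj_mat_carrier: "proj_mat X \<in> carrier_mat n n"
    and transpose_proj_mat: "transpose_mat (proj_mat X) = proj_mat X"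
    and proj_mat_mult_self: "proj_mat X * X = X"
    and proj_mat_idem: "proj_mat X * proj_mat X = proj_mat X"
    and proj_mat_orthogonal: "\<And>Y q. Y \<in> carrier_mat n q \<Longrightarrow> transpose_mat X * Y = 0\<^sub>m m q \<Longrightarrow>
      proj_mat X * Y = 0\<^sub>m n q"
proof -
  define A where "A = transpose_mat X * X"
  define G where "G = mp_inverse A"
  have A: "A \<in> carrier_mat m m" and As: "transpose_mat A = A"
    using X by (auto simp: A_def transpose_mult[of _ m n _ m])
  have "is_mp_inverse A G" unfolding G_def by (rule is_mp_inverse_symmetric[OF A As])
  then have G: "G \<in> carrier_mat m m" and AGA: "A * G * A = A"
    using A by (auto simp: is_mp_inverse_def)
  have Gs: "transpose_mat G = G"
    unfolding G_def by (rule transpose_mp_inverse[OF A As])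
  have Xt: "transpose_mat X \<in> carrier_mat m n" using X by simp
  have XG: "X * G \<in> carrier_mat n m" using X G by simp
  have P: "proj_mat X = X * G * transpose_mat X" by (simp add: proj_mat_def G_def A_def)
  show carr: "proj_mat X \<in> carrier_mat n n" using XG X by (simp add: P)
  show sym: "transpose_mat (proj_mat X) = proj_mat X"
    using X G Xt XG Gs by (simp add: P transpose_mult[of _ n m _ n] transpose_mult[of _ n m _ m] transpose_mult[of _ m m _ n] assoc_mult_mat[of _ n m _ m _ n])
  have PX: "proj_mat X * X = X * (G * A)"
    using X G Xt XG by (simp add: P A_def assoc_mult_mat[of _ n m _ n _ m] assoc_mult_mat[of _ n m _ m _ m])
  have GA: "G * A \<in> carrier_mat m m" using G A by simp
  \<comment> \<open>\<open>D\<close> lies in the column space of \<open>X\<close>, yet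
    \<open>X' * D = A * G * A - A = 0\<close>. Its Gram matrix therefore vanishes, and so does
    \<open>D\<close>.\<close>
  define D where "D = X * (G * A) - X"
  have D: "D \<in> carrier_mat n m" using X by (simp add: D_def minus_carrier_mat)
  have XD: "transpose_mat X * D = 0\<^sub>m m m"
  proof -
    have "transpose_mat X * D = A * (G * A) - A"
      using mult_minus_distrib_mat[OF Xt, of "X * (G * A)" m X] X GA
        assoc_mult_mat[OF Xt X GA] by (simp add: D_def A_def)
    also have "A * (G * A) = A" using AGA A G by (simp add: assoc_mult_mat[of _ m m _ m _ m])
    finally show ?thesis using A by simp
  qed
  have "transpose_mat D = (transpose_mat (G * A) - 1\<^sub>m m) * transpose_mat X"
    using X GA Xt by (simp add: D_def transpose_minus[of _ n m] transpose_mult[of _ n m _ m]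
        minus_mult_distrib_mat[of _ m m _ _ n])
  then have "transpose_mat D * D = (transpose_mat (G * A) - 1\<^sub>m m) * (transpose_mat X * D)"
    using GA Xt D by (simp add: assoc_mult_mat[of _ m m _ n _ m] minus_carrier_mat)
  also have "\<dots> = 0\<^sub>m m m" using GA by (simp add: XD minus_carrier_mat)
  finally have "D = 0\<^sub>m n m" using gram_eq_0_iff[of D] D by simp
  then show self: "proj_mat X * X = X"
    unfolding PX using minus_eq_0_mat[of "X * (G * A)" n m X] X GA by (simp add: D_def)
  have "proj_mat X * proj_mat X = proj_mat X * X * G * transpose_mat X"
    using X G Xt XG carr by (subst (2) P)
      (simp add: assoc_mult_mat[of _ n n _ m _ n] assoc_mult_mat[of _ n n _ m _ m] assoc_mult_mat[of _ n m _ m _ n])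
  then show "proj_mat X * proj_mat X = proj_mat X" by (simp only: self) (simp only: P)
  fix Y :: "real mat" and q assume "Y \<in> carrier_mat n q" "transpose_mat X * Y = 0\<^sub>m m q"
  then show "proj_mat X * Y = 0\<^sub>m n q"
    using XG Xt by (simp add: P assoc_mult_mat[of _ n m _ n _ q] right_mult_zero_mat[OF XG])
qed

lemma mp_inverse_smult_one:
  "c \<noteq> 0 \<Longrightarrow> mp_inverse (c \<cdot>\<^sub>m 1\<^sub>m t) = (1 / c) \<cdot>\<^sub>m 1\<^sub>m t"
  by (intro mp_inverse_eqI)
    (auto simp: is_mp_inverse_def mult_smult_distrib[of _ t t _ t] mult_smult_assoc_mat[of _ t t _ t])

section \<open>Concatenated matrices, nonnegative definiteness and the general information
  matrix\<close>

lemma dim_hcat [simp]: "dim_row (hcat U V) = dim_row U" "dim_col (hcat U V) = dim_col U + dim_col V"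
  by (simp_all add: hcat_def)

lemma hcat_carrier: "U \<in> carrier_mat n p \<Longrightarrow> V \<in> carrier_mat n q \<Longrightarrow> hcat U V \<in> carrier_mat n (p + q)"
  by (auto simp: hcat_def)

text \<open>Used for the projector onto the columns of (AM | B): it fixes B, so its complement
  eliminates the block effects.\<close>

lemma mult_hcat_right_part:
  fixes P :: "real mat"
  assumes "P \<in> carrier_mat n n" "U \<in> carrier_mat n p" "V \<in> carrier_mat n q"
    and eq: "P * hcat U V = hcat U V"
  shows "P * V = V"
proof (rule eq_matI)
  fix i j assume ij: "i < dim_row V" "j < dim_col V"
  then have "(P * V) $$ (i, j) = (P * hcat U V) $$ (i, p + j)"
    using assms(1-3) by (simp add: scalar_prod_def hcat_def)
  also have "\<dots> = V $$ (i, j)" using ij assms(1-3) by (simp add: eq) (simp add: hcat_def)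
  finally show "(P * V) $$ (i, j) = V $$ (i, j)" .
qed (use assms in auto)

lemma transpose_hcat_mult_eq_0:
  fixes Y :: "real mat"
  assumes "U \<in> carrier_mat n p" "V \<in> carrier_mat n q" "Y \<in> carrier_mat n s"
    and "transpose_mat U * Y = 0\<^sub>m p s" "transpose_mat V * Y = 0\<^sub>m q s"
  shows "transpose_mat (hcat U V) * Y = 0\<^sub>m (p + q) s"
proof (rule eq_matI)
  fix i j assume ij: "i < dim_row (0\<^sub>m (p + q) s)" "j < dim_col (0\<^sub>m (p + q) s)"
  show "(transpose_mat (hcat U V) * Y) $$ (i, j) = 0\<^sub>m (p + q) s $$ (i, j)"
  proof (cases "i < p")
    case True
    then have "(transpose_mat (hcat U V) * Y) $$ (i, j) = (transpose_mat U * Y) $$ (i, j)"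
      using ij assms(1-3) by (simp add: scalar_prod_def hcat_def)
    then show ?thesis using True ij by (simp add: assms)
  next
    case False
    then have "(transpose_mat (hcat U V) * Y) $$ (i, j) = (transpose_mat V * Y) $$ (i - p, j)"
      using ij assms(1-3) by (simp add: scalar_prod_def hcat_def)
    then show ?thesis using False ij by (simp add: assms)
  qed
qed (use assms in auto)

lemma nnd_sym_gram:
  assumes "Y \<in> carrier_mat n t"
  shows "nnd_sym t (transpose_mat Y * Y)"
  unfolding nnd_sym_def
proof (intro conjI ballI)
  show "transpose_mat Y * Y \<in> carrier_mat t t" using assms by simp
  show "transpose_mat (transpose_mat Y * Y) = transpose_mat Y * Y"
    using assms by (simp add: transpose_mult[of _ t n _ t])
  fix v :: "real vec" assume v: "v \<in> carrier_vec t"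
  have "v \<bullet> (transpose_mat Y * Y *\<^sub>v v) = v \<bullet> (transpose_mat Y *\<^sub>v (Y *\<^sub>v v))"
    using assms v by simp
  also have "\<dots> = (Y *\<^sub>v v) \<bullet> (Y *\<^sub>v v)"
    using transpose_vec_mult_scalar[of Y n t v "Y *\<^sub>v v"] assms v
    by (metis comm_scalar_prod mult_mat_vec_carrier transpose_carrier_mat)
  also have "\<dots> \<ge> 0" by (simp add: scalar_prod_def sum_nonneg)
  finally show "0 \<le> v \<bullet> (transpose_mat Y * Y *\<^sub>v v)" .
qed

lemma transpose_smult: "transpose_mat (a \<cdot>\<^sub>m A) = a \<cdot>\<^sub>m transpose_mat A"
  by (intro eq_matI) auto

lemma smult_mat_mult_vec:
  "C \<in> carrier_mat n m \<Longrightarrow> v \<in> carrier_vec m \<Longrightarrow> (a \<cdot>\<^sub>m C) *\<^sub>v v = a \<cdot>\<^sub>v (C *\<^sub>v v)"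
  by (intro eq_vecI) (auto simp: scalar_prod_def sum_distrib_left ac_simps)

lemma nnd_sym_smult: "nnd_sym t C \<Longrightarrow> 0 \<le> a \<Longrightarrow> nnd_sym t (a \<cdot>\<^sub>m C)"
  by (auto simp: nnd_sym_def transpose_smult smult_mat_mult_vec[of _ t t])

text \<open>The complement \<open>Q\<close> of the nuisance projector kills \<open>B\<close>, so
  \<open>A * K\<close> may be replaced by its centred part \<open>Y\<close>; Pythagoras for
  \<open>Y = Q * Y + P * Y\<close> gives the difference of Gram matrices with
  \<open>Z = P * Y\<close>. The factorization through \<open>Y\<close> transfers zero row sums from
  \<open>Y\<close> to the information matrix. If \<open>A' * Y = K * G\<close>, then
  \<open>(A * M)' * Y = M * K * G = 0\<close>: \<open>Y\<close> is orthogonal to every nuisance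
  column.\<close>

lemma info_mat_lin_decomposition:
  assumes A: "A \<in> carrier_mat n q" and B: "B \<in> carrier_mat n p" and K: "K \<in> carrier_mat q t"
    and KK: "transpose_mat K * K = c \<cdot>\<^sub>m 1\<^sub>m t" and c: "c \<noteq> 0"
    and Y: "Y \<in> carrier_mat n t" and W: "W \<in> carrier_mat p t"
    and AK: "A * K = Y + B * W" and BY: "transpose_mat B * Y = 0\<^sub>m p t"
  obtains Z R where "Z \<in> carrier_mat n t" "R \<in> carrier_mat t n" "info_mat_lin A B K = R * Y"
    "info_mat_lin A B K = (1 / c\<^sup>2) \<cdot>\<^sub>m (transpose_mat Y * Y - transpose_mat Z * Z)"
    "nnd_sym t (info_mat_lin A B K)"
    "\<And>G. G \<in> carrier_mat t t \<Longrightarrow> transpose_mat A * Y = K * G \<Longrightarrow> Z = 0\<^sub>m n t"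
proof -
  define M where "M = 1\<^sub>m q - (1 / c) \<cdot>\<^sub>m (K * transpose_mat K)"
  define X2 where "X2 = hcat (A * M) B"
  define P where "P = proj_mat X2"
  define Q where "Q = 1\<^sub>m n - P"
  have Kt: "transpose_mat K \<in> carrier_mat t q" using K by simp
  have KKt: "K * transpose_mat K \<in> carrier_mat q q" using K by simp
  have M: "M \<in> carrier_mat q q" using KKt by (simp add: M_def minus_carrier_mat)
  have AM: "A * M \<in> carrier_mat n q" using A M by simp
  have X2: "X2 \<in> carrier_mat n (q + p)" unfolding X2_def by (rule hcat_carrier[OF AM B])
  note P_props = proj_mat_carrier[OF X2, folded P_def] transpose_proj_mat[OF X2, folded P_def]
    proj_mat_idem[OF X2, folded P_def]
  have P: "P \<in> carrier_mat n n" by (rule P_props)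
  have PB: "P * B = B"
    by (rule mult_hcat_right_part[OF P AM B]) (use proj_mat_mult_self[OF X2] in \<open>simp add: P_def X2_def\<close>)
  have Q: "Q \<in> carrier_mat n n" using P by (simp add: Q_def minus_carrier_mat)
  have Qs: "transpose_mat Q = Q" using P P_props by (simp add: Q_def transpose_minus[of _ n n])
  have QQ: "Q * Q = Q"
  proof -
    have "Q * P = 0\<^sub>m n n"
      using P P_props by (simp add: Q_def minus_mult_distrib_mat[of _ n n _ _ n])
    then show ?thesis
      using Q P mult_minus_distrib_mat[OF Q one_carrier_mat P] by (simp add: Q_def[symmetric]) auto
  qed
  have QB: "Q * B = 0\<^sub>m n p"
    using P B by (simp add: Q_def minus_mult_distrib_mat[of _ n n _ _ p] PB)
  define R where "R = A * K"
  have R: "R \<in> carrier_mat n t" using A K by (simp add: R_def)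
  have BW: "B * W \<in> carrier_mat n t" using B W by simp
  have QR: "Q * R = Q * Y"
    using Q Y BW B W by (simp add: R_def AK mult_add_distrib_mat[of _ n n _ t]
        assoc_mult_mat[of _ n n _ p _ t, symmetric] QB)
  have X1: "A * K * mp_inverse (transpose_mat K * K) = (1 / c) \<cdot>\<^sub>m R"
    using R c by (simp add: KK mp_inverse_smult_one mult_smult_distrib[of _ n t _ t] R_def[symmetric])
  have M_eq: "1\<^sub>m (dim_row K) - K * mp_inverse (transpose_mat K * K) * transpose_mat K = M"
    using K Kt c by (simp add: KK mp_inverse_smult_one M_def mult_smult_distrib[of _ q t _ t] mult_smult_assoc_mat[of _ q t _ q])
  have "info_mat_lin A B K = transpose_mat ((1 / c) \<cdot>\<^sub>m R) * Q * ((1 / c) \<cdot>\<^sub>m R)"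
    using X2 unfolding info_mat_lin_def X1 M_eq Let_def by (simp add: X2_def[symmetric] proj_perp_def Q_def P_def)
  also have "\<dots> = (1 / c\<^sup>2) \<cdot>\<^sub>m (transpose_mat R * Q * R)"
  proof -
    have Rt: "transpose_mat R \<in> carrier_mat t n" and RtQ: "transpose_mat R * Q \<in> carrier_mat t n"
      using R Q by simp_all
    show ?thesis
      using mult_smult_assoc_mat[OF Rt Q, of "1 / c"] mult_smult_assoc_mat[OF RtQ, of R t "1 / c"] R
        mult_smult_distrib[of "(1 / c) \<cdot>\<^sub>m (transpose_mat R * Q)" t n R t "1 / c"] RtQ
      by (auto simp: transpose_smult power2_eq_square intro!: eq_matI)
  qed
  \<comment> \<open>Inserting \<open>Q = Q * Q\<close> exhibits a Gram matrix, which later gives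
    nonnegative definiteness.\<close>
  also have "transpose_mat R * Q * R = transpose_mat R * Q * (Q * R)"
    using R Q QQ by (simp add: assoc_mult_mat[of _ t n _ n _ t] assoc_mult_mat[of _ n n _ n _ t, symmetric])
  also have "transpose_mat R * Q = transpose_mat (Q * R)"
    using R Q Qs by (simp add: transpose_mult[of _ n n _ t])
  finally have info: "info_mat_lin A B K = (1 / c\<^sup>2) \<cdot>\<^sub>m (transpose_mat (Q * Y) * (Q * Y))"
    by (simp add: QR)
  define Z where "Z = P * Y"
  have Z: "Z \<in> carrier_mat n t" using P Y by (simp add: Z_def)
  have QY: "Q * Y = Y - Z"
    using P Y by (simp add: Q_def Z_def minus_mult_distrib_mat[of _ n n _ _ t])
  have QYt: "transpose_mat (Q * Y) * (Q * Y) = transpose_mat Y * (Q * Y)"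
  proof -
    have "transpose_mat (Q * Y) * (Q * Y) = transpose_mat Y * (Q * (Q * Y))"
      using Q Y Qs by (simp add: transpose_mult[of _ n n _ t] assoc_mult_mat[of _ t n _ n _ t])
    then show ?thesis using Q Y QQ by (simp add: assoc_mult_mat[of _ n n _ n _ t, symmetric])
  qed
  have "transpose_mat Z * Z = transpose_mat Y * (P * (P * Y))"
    using P Y P_props by (simp add: Z_def transpose_mult[of _ n n _ t] assoc_mult_mat[of _ t n _ n _ t])
  then have "transpose_mat Z * Z = transpose_mat Y * Z"
    using P Y P_props by (simp add: Z_def assoc_mult_mat[of _ n n _ n _ t, symmetric])
  then have decomp: "transpose_mat (Q * Y) * (Q * Y) = transpose_mat Y * Y - transpose_mat Z * Z"
    unfolding QYt using Y Z by (simp add: QY mult_minus_distrib_mat[of _ t n _ t])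
  show thesis
  proof (rule that[OF Z])
    \<comment> \<open>The witness for the left factor of \<open>Y\<close>; it differs from the local
      \<open>R = A * K\<close>.\<close>
    show "(1 / c\<^sup>2) \<cdot>\<^sub>m (transpose_mat (Q * Y) * Q) \<in> carrier_mat t n"
      using Q Y by (intro carrier_matI) auto
    show "info_mat_lin A B K = (1 / c\<^sup>2) \<cdot>\<^sub>m (transpose_mat (Q * Y) * Q) * Y"
    proof -
      have QYt: "transpose_mat (Q * Y) \<in> carrier_mat t n" using Q Y by simp
      show ?thesis
        using mult_smult_assoc_mat[OF mult_carrier_mat[OF QYt Q] Y] assoc_mult_mat[OF QYt Q Y]
        by (simp add: info)
    qed
    show "info_mat_lin A B K = (1 / c\<^sup>2) \<cdot>\<^sub>m (transpose_mat Y * Y - transpose_mat Z * Z)"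
      by (simp add: info decomp)
    show "nnd_sym t (info_mat_lin A B K)"
      unfolding info using Q Y by (intro nnd_sym_smult nnd_sym_gram[of _ n]) auto
    fix G assume G: "G \<in> carrier_mat t t" and AY: "transpose_mat A * Y = K * G"
    have Ms: "transpose_mat M = M"
      using KKt K by (simp add: M_def transpose_minus[of _ q q] transpose_smult transpose_mult[of _ q t _ q])
    have MK: "M * K = 0\<^sub>m q t"
    proof -
      have "(1 / c) \<cdot>\<^sub>m (K * transpose_mat K) * K = (1 / c) \<cdot>\<^sub>m (K * (c \<cdot>\<^sub>m 1\<^sub>m t))"
        using K Kt KKt by (simp add: mult_smult_assoc_mat[of _ q q _ t] assoc_mult_mat[of _ q t _ q _ t] KK)
      also have "\<dots> = K" using K c by (auto simp: mult_smult_distrib[of _ q t _ t] intro!: eq_matI)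
      finally show ?thesis using K KKt by (simp add: M_def minus_mult_distrib_mat[of _ q q _ _ t])
    qed
    have At: "transpose_mat A \<in> carrier_mat q n" using A by simp
    have "transpose_mat (A * M) * Y = M * (K * G)"
      using A M At Y by (simp add: transpose_mult[of _ n q _ q] Ms assoc_mult_mat[of _ q q _ n _ t] AY)
    also have "\<dots> = 0\<^sub>m q t"
      using M K G by (simp add: assoc_mult_mat[of _ q q _ t _ t, symmetric] MK)
    finally have "transpose_mat X2 * Y = 0\<^sub>m (q + p) t"
      unfolding X2_def by (intro transpose_hcat_mult_eq_0[OF AM B Y] BY)
    then show "Z = 0\<^sub>m n t"
      unfolding Z_def P_def by (rule proj_mat_orthogonal[OF X2 Y])
  qed
qed

subsection \<open>Kiefer criteria and centring matrices\<close>

text \<open>Up to a scalar, the only permutation invariant matrix with zero row sums.\<close>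

definition centering_mat :: "nat \<Rightarrow> real mat" where
  "centering_mat t = mat t t (\<lambda>(i, j). (if i = j then 1 else 0) - 1 / real t)"

definition permute_mat :: "nat \<Rightarrow> (nat \<Rightarrow> nat) \<Rightarrow> real mat \<Rightarrow> real mat" where
  "permute_mat t \<sigma> C = mat t t (\<lambda>(i, j). C $$ (\<sigma> i, \<sigma> j))"

text \<open>The index set is left general because convexity is applied by induction over finite
  sets.\<close>

definition mat_average :: "nat \<Rightarrow> 'i set \<Rightarrow> ('i \<Rightarrow> real mat) \<Rightarrow> real mat" where
  "mat_average t S C = mat t t (\<lambda>(i, j). (\<Sum>\<sigma>\<in>S. C \<sigma> $$ (i, j)) / real (card S))"

text \<open>With functions as test vectors, a permutation of rows and columns becomes a reindexing
  of sums.\<close>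

lemma nnd_sym_iff:
  "nnd_sym t C \<longleftrightarrow> C \<in> carrier_mat t t \<and> (\<forall>i<t. \<forall>j<t. C $$ (i, j) = C $$ (j, i)) \<and>
    (\<forall>f. 0 \<le> (\<Sum>i<t. \<Sum>j<t. f i * f j * C $$ (i, j)))"
proof -
  have sym: "transpose_mat C = C \<longleftrightarrow> (\<forall>i<t. \<forall>j<t. C $$ (i, j) = C $$ (j, i))"
    if "C \<in> carrier_mat t t"
    using that by (auto simp: mat_eq_iff)
  have quad: "v \<bullet> (C *\<^sub>v v) = (\<Sum>i<t. \<Sum>j<t. v $ i * v $ j * C $$ (i, j))"
    if "C \<in> carrier_mat t t" "v \<in> carrier_vec t" for v
    using that by (simp add: scalar_prod_def sum_distrib_left atLeast0LessThan ac_simps)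
  have "(\<forall>v\<in>carrier_vec t. 0 \<le> (\<Sum>i<t. \<Sum>j<t. v $ i * v $ j * C $$ (i, j))) \<longleftrightarrow>
    (\<forall>f. 0 \<le> (\<Sum>i<t. \<Sum>j<t. f i * f j * C $$ (i, j)))" (is "?L \<longleftrightarrow> ?R")
  proof
    assume ?L
    show ?R
    proof
      fix f :: "nat \<Rightarrow> real"
      show "0 \<le> (\<Sum>i<t. \<Sum>j<t. f i * f j * C $$ (i, j))"
        using \<open>?L\<close>[rule_format, of "vec t f"] by simp
    qed
  qed simp
  then show ?thesis using sym quad by (auto simp: nnd_sym_def)
qed

lemma nnd_symD: "nnd_sym t C \<Longrightarrow> C \<in> carrier_mat t t"
  by (simp add: nnd_sym_def)

lemma nnd_sym_permute_mat:
  assumes C: "nnd_sym t C" and \<sigma>: "\<sigma> permutes {..<t}"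
  shows "nnd_sym t (permute_mat t \<sigma> C)"
proof -
  have bij: "bij_betw \<sigma> {..<t} {..<t}" using \<sigma> by (rule permutes_imp_bij)
  have lt: "\<sigma> i < t" if "i < t" for i using permutes_in_image[OF \<sigma>, of i] that by simp
  have "0 \<le> (\<Sum>i<t. \<Sum>j<t. f i * f j * C $$ (\<sigma> i, \<sigma> j))" for f :: "nat \<Rightarrow> real"
  proof -
    \<comment> \<open>Moving the test vector by the inverse permutation undoes the permutation of
      \<open>C\<close>.\<close>
    define g where "g i = f (inv_into UNIV \<sigma> i)" for i
    have "(\<Sum>i<t. \<Sum>j<t. f i * f j * C $$ (\<sigma> i, \<sigma> j)) =
      (\<Sum>i<t. \<Sum>j<t. g (\<sigma> i) * g (\<sigma> j) * C $$ (\<sigma> i, \<sigma> j))"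
      by (simp add: g_def permutes_inverses[OF \<sigma>])
    also have "\<dots> = (\<Sum>i<t. \<Sum>j<t. g (\<sigma> i) * g j * C $$ (\<sigma> i, j))"
      by (intro sum.cong refl sum.reindex_bij_betw[OF bij])
    also have "\<dots> = (\<Sum>i<t. \<Sum>j<t. g i * g j * C $$ (i, j))"
      by (rule sum.reindex_bij_betw[OF bij])
    finally show ?thesis using C by (simp add: nnd_sym_iff)
  qed
  then show ?thesis using C lt by (simp add: nnd_sym_iff permute_mat_def)
qed

lemma nnd_sym_mat_average:
  assumes "\<And>\<sigma>. \<sigma> \<in> S \<Longrightarrow> nnd_sym t (C \<sigma>)"
  shows "nnd_sym t (mat_average t S C)"
proof -
  have "(\<Sum>i<t. \<Sum>j<t. f i * f j * mat_average t S C $$ (i, j)) =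
    (\<Sum>\<sigma>\<in>S. \<Sum>i<t. \<Sum>j<t. f i * f j * C \<sigma> $$ (i, j)) / real (card S)" for f :: "nat \<Rightarrow> real"
    by (simp add: mat_average_def sum_distrib_left sum_divide_distrib sum.swap[of _ S] ac_simps)
  then show ?thesis using assms
    by (simp add: nnd_sym_iff sum_nonneg) (simp add: mat_average_def)
qed

text \<open>Jensen's inequality for equal weights. A common bound \<open>v\<close> instead of the
  mean of the values is enough, as all permuted copies share one value, and it reduces arithmetic
  with infinities to \<open>x * v + (1 - x) * v = v\<close>.\<close>

lemma kiefer_criterion_average_le:
  assumes \<Phi>: "kiefer_criterion t \<Phi>" and "finite S" "S \<noteq> {}"
    and C: "\<And>\<sigma>. \<sigma> \<in> S \<Longrightarrow> nnd_sym t (C \<sigma>)" "\<And>\<sigma>. \<sigma> \<in> S \<Longrightarrow> \<Phi> (C \<sigma>) \<le> v"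
  shows "\<Phi> (mat_average t S C) \<le> v"
  using assms(2,3) C
proof (induction S rule: finite_ne_induct)
  case (singleton \<sigma>)
  have "mat_average t {\<sigma>} C = C \<sigma>"
    using singleton.prems(1)[of \<sigma>] by (auto simp: mat_average_def nnd_sym_def intro!: eq_matI)
  then show ?case using singleton by simp
next
  case (insert \<sigma> S)
  \<comment> \<open>The weight of the new member. Starting from singletons keeps it strictly below
    1, as the convexity condition demands.\<close>
  define x :: real where "x = 1 / real (card (insert \<sigma> S))"
  have n: "0 < card S" using insert by (simp add: card_gt_0_iff)
  have x: "0 < x" "x < 1" using insert n by (simp_all add: x_def)
  have avg: "mat_average t (insert \<sigma> S) C = x \<cdot>\<^sub>m C \<sigma> + (1 - x) \<cdot>\<^sub>m mat_average t S C"
  proof (rule eq_matI)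
    fix i j assume "i < dim_row (x \<cdot>\<^sub>m C \<sigma> + (1 - x) \<cdot>\<^sub>m mat_average t S C)"
      "j < dim_col (x \<cdot>\<^sub>m C \<sigma> + (1 - x) \<cdot>\<^sub>m mat_average t S C)"
    then have ij: "i < t" "j < t" by (simp_all add: mat_average_def)
    have "1 - x = real (card S) * x"
      using insert n by (simp add: x_def field_simps)
    then show "mat_average t (insert \<sigma> S) C $$ (i, j) = (x \<cdot>\<^sub>m C \<sigma> + (1 - x) \<cdot>\<^sub>m mat_average t S C) $$ (i, j)"
      using ij insert n insert.prems(1)[of \<sigma>, THEN nnd_symD]
      by (simp add: mat_average_def x_def add_divide_distrib)
  qed (use insert.prems(1)[of \<sigma>] in \<open>auto simp: mat_average_def nnd_sym_def\<close>)
  have nnd: "nnd_sym t (C \<sigma>)" "nnd_sym t (mat_average t S C)"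
    using insert.prems by (auto intro!: nnd_sym_mat_average)
  have le: "\<Phi> (C \<sigma>) \<le> v" "\<Phi> (mat_average t S C) \<le> v" using insert by auto
  have conv: "\<Phi> (mat_average t (insert \<sigma> S) C) \<le> ereal x * \<Phi> (C \<sigma>) + ereal (1 - x) * \<Phi> (mat_average t S C)"
    unfolding avg using \<Phi> nnd x by (auto simp: kiefer_criterion_def)
  also have "\<dots> \<le> ereal x * v + ereal (1 - x) * v"
    using le x by (intro add_mono ereal_mult_left_mono) auto
  also have "\<dots> = v"
    using x by (cases v) (auto simp: algebra_simps)
  finally show ?case .
qed

text \<open>Averaging over all simultaneous permutations leaves only the trace of a matrix with zero row sums:
  invariance under the transpositions fixing an index already makes the off-diagonal entries of its row equal.\<close>

lemma permutation_average_eq_centering: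
  assumes C: "C \<in> carrier_mat t t" and rows: "\<And>i. i < t \<Longrightarrow> (\<Sum>j<t. C $$ (i, j)) = 0" and t: "2 \<le> t"
  shows "mat_average t {\<sigma>. \<sigma> permutes {..<t}} (\<lambda>\<sigma>. permute_mat t \<sigma> C) =
    ((\<Sum>i<t. C $$ (i, i)) / (real t - 1)) \<cdot>\<^sub>m centering_mat t"
proof -
  define S where "S = {\<sigma>. \<sigma> permutes {..<t}}"
  define D where "D i j = (\<Sum>\<sigma>\<in>S. C $$ (\<sigma> i, \<sigma> j)) / real (card S)" for i j
  define \<tau> where "\<tau> = (\<Sum>i<t. C $$ (i, i))"
  have fin: "finite S" and card: "card S \<noteq> 0"
    by (auto simp: S_def finite_permutations intro: permutes_id)
  \<comment> \<open>Right composition with \<open>\<pi>\<close> is a bijection of the symmetric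
    group.\<close>
  have inv: "D (\<pi> i) (\<pi> j) = D i j" if "\<pi> permutes {..<t}" for \<pi> i j
  proof -
    have "(\<Sum>\<sigma>\<in>S. C $$ (\<sigma> (\<pi> i), \<sigma> (\<pi> j))) = (\<Sum>\<sigma>\<in>S. C $$ (\<sigma> i, \<sigma> j))"
      using sum_permutations_compose_right[OF that, of "\<lambda>\<sigma>. C $$ (\<sigma> i, \<sigma> j)"] by (simp add: S_def)
    then show ?thesis by (simp add: D_def)
  qed
  have diag: "D i i = D j j" if "i < t" "j < t" for i j
    using inv[OF permutes_swap_id[of i "{..<t}" j], of i i] that by simp
  have off: "D i j = D i j'" if "i < t" "j < t" "j' < t" "j \<noteq> i" "j' \<noteq> i" for i j j'
    using inv[OF permutes_swap_id[of j "{..<t}" j'], of i j] that by simp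
  have reindex: "(\<Sum>j<t. g (\<sigma> j)) = (\<Sum>j<t. g j)" if "\<sigma> \<in> S" for \<sigma> and g :: "nat \<Rightarrow> real"
    using that by (intro sum.reindex_bij_betw permutes_imp_bij) (simp add: S_def)
  have row0: "(\<Sum>j<t. D i j) = 0" if "i < t" for i
  proof -
    have "(\<Sum>j<t. D i j) = (\<Sum>\<sigma>\<in>S. \<Sum>j<t. C $$ (\<sigma> i, \<sigma> j)) / real (card S)"
      by (simp add: D_def sum_divide_distrib sum.swap[of _ S])
    also have "(\<Sum>\<sigma>\<in>S. \<Sum>j<t. C $$ (\<sigma> i, \<sigma> j)) = 0"
    proof (rule sum.neutral, rule ballI)
      fix \<sigma> assume \<sigma>: "\<sigma> \<in> S"
      then have "\<sigma> i < t" using that permutes_in_image[of \<sigma> "{..<t}" i] by (simp add: S_def)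
      then show "(\<Sum>j<t. C $$ (\<sigma> i, \<sigma> j)) = 0"
        using reindex[OF \<sigma>, of "\<lambda>j. C $$ (\<sigma> i, j)"] rows by simp
    qed
    finally show ?thesis by simp
  qed
  have "(\<Sum>i<t. D i i) = (\<Sum>\<sigma>\<in>S. \<Sum>i<t. C $$ (\<sigma> i, \<sigma> i)) / real (card S)"
    by (simp add: D_def sum_divide_distrib sum.swap[of _ S])
  also have "\<dots> = \<tau>" using card by (simp add: reindex[of _ "\<lambda>i. C $$ (i, i)"] \<tau>_def)
  finally have tr: "(\<Sum>i<t. D i i) = \<tau>" .
  have D_diag: "D i i = \<tau> / real t" if "i < t" for i
  proof -
    have "(\<Sum>j<t. D j j) = (\<Sum>j<t. D i i)" using that by (intro sum.cong diag) auto
    then show ?thesis using tr t by (simp add: field_simps)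
  qed
  \<comment> \<open>The zero row sum spreads the negated diagonal entry over \<open>t - 1\<close>
    equal entries.\<close>
  have D_off: "D i j = - \<tau> / (real t * (real t - 1))" if "i < t" "j < t" "i \<noteq> j" for i j
  proof -
    have "(\<Sum>j'<t. D i j') = D i i + (\<Sum>j'\<in>{..<t} - {i}. D i j')"
      using that by (simp add: sum.remove)
    also have "(\<Sum>j'\<in>{..<t} - {i}. D i j') = (\<Sum>j'\<in>{..<t} - {i}. D i j)"
      using that by (intro sum.cong off) auto
    finally have "D i i + (real t - 1) * D i j = 0" using row0[OF that(1)] that t by (simp add: of_nat_diff)
    then show ?thesis using D_diag[OF that(1)] t by (simp add: field_simps)
  qed
  have "mat_average t S (\<lambda>\<sigma>. permute_mat t \<sigma> C) = (\<tau> / (real t - 1)) \<cdot>\<^sub>m centering_mat t"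
  proof (rule eq_matI)
    fix i j assume "i < dim_row ((\<tau> / (real t - 1)) \<cdot>\<^sub>m centering_mat t)" "j < dim_col ((\<tau> / (real t - 1)) \<cdot>\<^sub>m centering_mat t)"
    then have ij: "i < t" "j < t" by (simp_all add: centering_mat_def)
    have "mat_average t S (\<lambda>\<sigma>. permute_mat t \<sigma> C) $$ (i, j) = D i j"
      using ij by (simp add: mat_average_def permute_mat_def D_def)
    then show "mat_average t S (\<lambda>\<sigma>. permute_mat t \<sigma> C) $$ (i, j) = ((\<tau> / (real t - 1)) \<cdot>\<^sub>m centering_mat t) $$ (i, j)"
      using ij t by (cases "i = j") (auto simp: D_diag D_off centering_mat_def field_simps)
  qed (simp_all add: mat_average_def centering_mat_def)
  then show ?thesis by (simp add: S_def \<tau>_def)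
qed

lemma nnd_sym_centering_mat: "nnd_sym t (centering_mat t)"
proof -
  have "0 \<le> (\<Sum>i<t. \<Sum>j<t. f i * f j * ((if i = j then 1 else 0) - 1 / real t))" for f :: "nat \<Rightarrow> real"
  proof (cases "t = 0")
    case False
    have "(\<Sum>i<t. \<Sum>j<t. f i * f j * ((if i = j then 1 else 0) - 1 / real t)) =
      (\<Sum>i<t. (f i)\<^sup>2) - (\<Sum>i<t. f i)\<^sup>2 / real t"
      by (simp add: right_diff_distrib sum_subtractf if_distrib[of "(*) _"] power2_eq_square
          sum_product sum_divide_distrib cong: if_cong)
    \<comment> \<open>The form is the sum of squared deviations of \<open>f\<close> from its
      mean.\<close>
    also have "\<dots> = (\<Sum>i<t. (f i - (\<Sum>i<t. f i) / real t)\<^sup>2)"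
      using False by (simp add: power2_diff sum.distrib sum_subtractf power2_eq_square field_simps
          flip: sum_distrib_left sum_distrib_right sum_divide_distrib)
    also have "\<dots> \<ge> 0" by (simp add: sum_nonneg)
    finally show ?thesis .
  qed simp
  then show ?thesis by (simp add: nnd_sym_iff centering_mat_def)
qed

text \<open>Averaging brings \<open>C\<close> onto the ray of the centring matrix, where the trace
  hypothesis is exactly a comparison of coefficients.\<close>

lemma kiefer_criterion_centering_le:
  assumes \<Phi>: "kiefer_criterion t \<Phi>" and C: "nnd_sym t C" and t: "2 \<le> t"
    and rows: "\<And>i. i < t \<Longrightarrow> (\<Sum>j<t. C $$ (i, j)) = 0"
    and tr: "(\<Sum>i<t. C $$ (i, i)) \<le> (real t - 1) * a"
  shows "\<Phi> (a \<cdot>\<^sub>m centering_mat t) \<le> \<Phi> C"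
proof -
  define S where "S = {\<sigma>. \<sigma> permutes {..<t}}"
  define \<tau> where "\<tau> = (\<Sum>i<t. C $$ (i, i))"
  have "0 \<le> C $$ (i, i)" if "i < t" for i
  proof -
    \<comment> \<open>Unit test vectors. The trace must be nonnegative because monotonicity covers
      only nonnegative factors.\<close>
    have "0 \<le> (\<Sum>j<t. \<Sum>j'<t. of_bool (j = i) * of_bool (j' = i) * C $$ (j, j'))"
      using C unfolding nnd_sym_iff by fast
    also have "\<dots> = (\<Sum>j<t. if j = i then C $$ (i, i) else 0)"
      using that by (intro sum.cong) (auto simp: of_bool_def if_distrib[of "\<lambda>x. x * _"] cong: if_cong)
    also have "\<dots> = C $$ (i, i)" using that by simp
    finally show ?thesis .
  qed
  then have \<tau>: "0 \<le> \<tau>" unfolding \<tau>_def by (intro sum_nonneg) auto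
  have "\<Phi> (a \<cdot>\<^sub>m centering_mat t) \<le> \<Phi> ((\<tau> / (real t - 1)) \<cdot>\<^sub>m centering_mat t)"
  proof -
    have "0 \<le> \<tau> / (real t - 1)" "\<tau> / (real t - 1) \<le> a"
      using \<tau> t tr by (simp_all add: \<tau>_def divide_le_eq mult.commute)
    then show ?thesis using \<Phi> nnd_sym_centering_mat by (auto simp: kiefer_criterion_def)
  qed
  also have "\<dots> = \<Phi> (mat_average t S (\<lambda>\<sigma>. permute_mat t \<sigma> C))"
    using permutation_average_eq_centering[OF _ rows t] C by (simp add: S_def \<tau>_def nnd_sym_def)
  also have "\<dots> \<le> \<Phi> C"
  proof (rule kiefer_criterion_average_le[OF \<Phi>])
    show "finite S" "S \<noteq> {}" by (auto simp: S_def finite_permutations intro: permutes_id)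
    fix \<sigma> assume "\<sigma> \<in> S"
    then show "nnd_sym t (permute_mat t \<sigma> C)" "\<Phi> (permute_mat t \<sigma> C) \<le> \<Phi> C"
      using C \<Phi> nnd_sym_permute_mat by (auto simp: S_def kiefer_criterion_def permute_mat_def)
  qed
  finally show ?thesis .
qed

subsection \<open>Information matrices of circular designs\<close>

lemma sum_div_mod: "(\<Sum>r<n * k. f (r div k) (r mod k)) = (\<Sum>i<n. \<Sum>j<k. f i j)"
  for f :: "nat \<Rightarrow> nat \<Rightarrow> 'a :: comm_monoid_add"
proof -
  have "(\<Sum>r\<in>{i * k..<i * k + k}. f (r div k) (r mod k)) = (\<Sum>j<k. f i j)" for i
    unfolding sum.atLeastLessThan_shift_0[of _ "i * k"]
    by (rule sum.cong) auto
  then show ?thesis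
    by (simp flip: sum.nat_group)
qed

text \<open>Both sides are the sum over \<open>0..k\<close> with one of two equal end terms dropped.
  Circularity enters the plot counts in this form.\<close>

lemma sum_cyclic_shift:
  fixes g :: "nat \<Rightarrow> 'a :: ab_group_add"
  assumes "g 0 = g k"
  shows "(\<Sum>j<k. g (Suc j)) = (\<Sum>j<k. g j)"
  using sum.lessThan_Suc_shift[of g k] sum.lessThan_Suc[of g k] assms by (simp add: add.commute)

text \<open>Multiplication by \<open>K_mat\<close> adds column \<open>c\<close> of the neighbour
  half to column \<open>c\<close> of the treatment half.\<close>

lemma sum_mult_mod_eq:
  fixes f :: "nat \<Rightarrow> real"
  assumes "c < t"
  shows "(\<Sum>s<2 * t. f s * (if s mod t = c then 1 else 0)) = f c + f (t + c)"
proof -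
  have "(\<Sum>s<2 * t. f s * (if s mod t = c then 1 else 0)) =
    (\<Sum>s<2 * t. f (s div t * t + s mod t) * (if s mod t = c then 1 else 0))" by simp
  also have "\<dots> = (\<Sum>i<2. \<Sum>j<t. f (i * t + j) * (if j = c then 1 else 0))"
    by (rule sum_div_mod[of "\<lambda>i j. f (i * t + j) * (if j = c then 1 else 0)"])
  also have "\<dots> = f c + f (t + c)"
    using assms by (simp add: if_distrib[of "(*) _"] numeral_2_eq_2 cong: if_cong)
  finally show ?thesis .
qed

section \<open>Plot counts and indicators of a design\<close>

lemma real_card_plots:
  "real (card {(i, j). i \<in> {1..b} \<and> j \<in> {1..k} \<and> P i j}) =
    (\<Sum>i<b. \<Sum>j<k. of_bool (P (Suc i) (Suc j)))"
proof -
  have "{(i, j). i \<in> {1..b} \<and> j \<in> {1..k} \<and> P i j} = {p \<in> {1..b} \<times> {1..k}. P (fst p) (snd p)}" by auto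
  then have "real (card {(i, j). i \<in> {1..b} \<and> j \<in> {1..k} \<and> P i j}) =
    (\<Sum>p\<in>{1..b} \<times> {1..k}. of_bool (P (fst p) (snd p)))" by (simp add: Int_def)
  also have "\<dots> = (\<Sum>i\<in>{1..b}. \<Sum>j\<in>{1..k}. of_bool (P i j))"
    by (subst sum.cartesian_product) (simp only: case_prod_unfold)
  also have "\<dots> = (\<Sum>i<b. \<Sum>j<k. of_bool (P (Suc i) (Suc j)))"
    by (simp add: sum.atLeast1_atMost_eq)
  finally show ?thesis .
qed

text \<open>Blocks, plots and treatments are counted from 0 here but from 1 in \<open>d\<close>. The
  plot with index \<open>j\<close> is \<open>Suc j\<close> in \<open>d\<close>, so its left
  neighbour is \<open>j\<close>, with the border plot read at \<open>j = 0\<close>.\<close>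

definition treat_ind :: "(nat \<Rightarrow> nat \<Rightarrow> nat) \<Rightarrow> nat \<Rightarrow> nat \<Rightarrow> nat \<Rightarrow> real" where
  "treat_ind d i j a = of_bool (d (Suc i) (Suc j) = Suc a)"

definition left_ind :: "(nat \<Rightarrow> nat \<Rightarrow> nat) \<Rightarrow> nat \<Rightarrow> nat \<Rightarrow> nat \<Rightarrow> real" where
  "left_ind d i j a = of_bool (d (Suc i) j = Suc a)"

definition block_count :: "nat \<Rightarrow> (nat \<Rightarrow> nat \<Rightarrow> nat) \<Rightarrow> nat \<Rightarrow> nat \<Rightarrow> real" where
  "block_count k d i a = (\<Sum>j<k. treat_ind d i j a)"

text \<open>An entry of T + L centred within blocks. The block mean is \<open>2 * n / k\<close>
  since T and L have equal block totals in a circular design.\<close>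

definition centered_total :: "nat \<Rightarrow> (nat \<Rightarrow> nat \<Rightarrow> nat) \<Rightarrow> nat \<Rightarrow> nat \<Rightarrow> nat \<Rightarrow> real" where
  "centered_total k d i j a = treat_ind d i j a + left_ind d i j a - 2 * block_count k d i a / real k"

definition centered_total_mat :: "nat \<Rightarrow> nat \<Rightarrow> nat \<Rightarrow> (nat \<Rightarrow> nat \<Rightarrow> nat) \<Rightarrow> real mat" where
  "centered_total_mat t b k d = mat (b * k) t (\<lambda>(r, a). centered_total k d (r div k) (r mod k) a)"

lemma K_mat_gram: "transpose_mat (K_mat t) * K_mat t = 2 \<cdot>\<^sub>m 1\<^sub>m t"
proof (rule eq_matI)
  fix a c assume "a < dim_row (2 \<cdot>\<^sub>m 1\<^sub>m t :: real mat)" "c < dim_col (2 \<cdot>\<^sub>m 1\<^sub>m t :: real mat)"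
  then show "(transpose_mat (K_mat t) * K_mat t) $$ (a, c) = (2 \<cdot>\<^sub>m 1\<^sub>m t) $$ (a, c)"
    using sum_mult_mod_eq[of c t "\<lambda>s. if s mod t = a then 1 else 0"]
    by (simp add: K_mat_def scalar_prod_def atLeast0LessThan)
qed (simp_all add: K_mat_def)

section \<open>Circular designs: Gram matrix, information matrix and trace bound\<close>

context
  fixes t b k :: nat and d :: "nat \<Rightarrow> nat \<Rightarrow> nat"
  assumes circ: "circular_design t b k d" and k: "0 < k"
begin

lemma design_borders: "i < b \<Longrightarrow> d (Suc i) 0 = d (Suc i) k \<and> d (Suc i) (Suc k) = d (Suc i) (Suc 0)"
  using circ by (auto simp: circular_design_def)

lemma design_range: "i < b \<Longrightarrow> j \<le> k \<Longrightarrow> d (Suc i) j \<in> {1..t}"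
  using circ by (auto simp: circular_design_def)

text \<open>On a circle every inner plot is the left neighbour of exactly one inner plot.\<close>

lemma sum_left_ind:
  assumes "i < b"
  shows "(\<Sum>j<k. left_ind d i j a) = block_count k d i a"
  using sum_cyclic_shift[of "\<lambda>j. left_ind d i j a" k] design_borders[OF assms]
  by (simp add: block_count_def left_ind_def treat_ind_def)

text \<open>The range \<open>j \<le> k\<close> covers rows of L at \<open>j\<close> and rows of T at
  \<open>Suc j\<close>.\<close>

lemma sum_ind_treatments:
  assumes "i < b" "j \<le> k"
  shows "(\<Sum>a<t. left_ind d i j a) = 1"
proof -
  have "(\<Sum>a<t. left_ind d i j a) = (\<Sum>a<t. if a = d (Suc i) j - 1 then 1 else 0)"
    using design_range[OF assms] by (intro sum.cong) (auto simp: left_ind_def)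
  also have "\<dots> = 1"
  proof -
    have "d (Suc i) j - 1 < t" using design_range[OF assms] by auto
    then show ?thesis by simp
  qed
  finally show ?thesis .
qed

lemma treat_ind_eq_left_ind: "treat_ind d i j a = left_ind d i (Suc j) a"
  by (simp add: treat_ind_def left_ind_def)

lemma sum_block_count: "i < b \<Longrightarrow> (\<Sum>a<t. block_count k d i a) = real k"
  by (simp add: block_count_def sum.swap[of _ "{..<k}"] treat_ind_eq_left_ind sum_ind_treatments)

lemma sum_centered_total_treatments:
  assumes "i < b" "j < k"
  shows "(\<Sum>a<t. centered_total k d i j a) = 0"
proof -
  have "(\<Sum>a<t. centered_total k d i j a) = 1 + 1 - 2 * (\<Sum>a<t. block_count k d i a) / real k"
    using assms by (simp add: centered_total_def sum.distrib sum_subtractf treat_ind_eq_left_ind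
        sum_ind_treatments sum_distrib_left sum_divide_distrib)
  then show ?thesis using assms k by (simp add: sum_block_count)
qed

lemma sum_centered_total_block: "i < b \<Longrightarrow> (\<Sum>j<k. centered_total k d i j a) = 0"
  using k by (simp add: centered_total_def sum.distrib sum_subtractf sum_left_ind block_count_def[symmetric])

lemma centered_total_gram:
  assumes a: "a < t" and c: "c < t"
  shows "(transpose_mat (centered_total_mat t b k d) * centered_total_mat t b k d) $$ (a, c) =
    (\<Sum>i<b. (\<Sum>j<k. (treat_ind d i j a + left_ind d i j a) * (treat_ind d i j c + left_ind d i j c))
       - 4 * block_count k d i a * block_count k d i c / real k)"
proof -
  have "(transpose_mat (centered_total_mat t b k d) * centered_total_mat t b k d) $$ (a, c) =
    (\<Sum>r<b * k. centered_total k d (r div k) (r mod k) a * centered_total k d (r div k) (r mod k) c)"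
    using a c by (simp add: centered_total_mat_def scalar_prod_def atLeast0LessThan)
  also have "\<dots> = (\<Sum>i<b. \<Sum>j<k. centered_total k d i j a * centered_total k d i j c)"
    by (rule sum_div_mod)
  also have "\<dots> = (\<Sum>i<b. (\<Sum>j<k. (treat_ind d i j a + left_ind d i j a) * (treat_ind d i j c + left_ind d i j c))
       - 4 * block_count k d i a * block_count k d i c / real k)"
  proof (rule sum.cong[OF refl])
    fix i assume "i \<in> {..<b}"
    then have i: "i < b" by simp
    let ?s = "\<lambda>j a. treat_ind d i j a + left_ind d i j a" and ?n = "block_count k d i"
    have s: "(\<Sum>j<k. ?s j a) = 2 * ?n a" for a
      using i by (simp add: sum.distrib sum_left_ind block_count_def)
    \<comment> \<open>The first factor already sums to 0 over the block, so centring the second one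
      changes nothing.\<close>
    have "(\<Sum>j<k. centered_total k d i j a * centered_total k d i j c) =
      (\<Sum>j<k. centered_total k d i j a * ?s j c) - (\<Sum>j<k. centered_total k d i j a) * (2 * ?n c / real k)"
      by (simp add: centered_total_def[of _ _ _ _ c] right_diff_distrib sum_subtractf sum_distrib_right sum_divide_distrib)
    also have "\<dots> = (\<Sum>j<k. ?s j a * ?s j c) - 2 * ?n a / real k * (\<Sum>j<k. ?s j c)"
      using i by (simp add: sum_centered_total_block) (simp add: centered_total_def left_diff_distrib sum_subtractf sum_distrib_left sum_divide_distrib)
    finally show "(\<Sum>j<k. centered_total k d i j a * centered_total k d i j c) =
      (\<Sum>j<k. ?s j a * ?s j c) - 4 * ?n a * ?n c / real k" by (simp add: s)
  qed
  finally show ?thesis .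
qed

text \<open>The general decomposition with A = (T | L) and \<open>c = 2\<close>. Symmetry of T'L
  gives T'Y = L'Y, that is, orthogonality of Y to T - L.\<close>

lemma info_total_decomposition:
  obtains Z R where "Z \<in> carrier_mat (b * k) t" "R \<in> carrier_mat t (b * k)"
    "info_total t b k d = R * centered_total_mat t b k d"
    "info_total t b k d = (1 / 4) \<cdot>\<^sub>m
      (transpose_mat (centered_total_mat t b k d) * centered_total_mat t b k d - transpose_mat Z * Z)"
    "nnd_sym t (info_total t b k d)"
    "(\<forall>a<t. \<forall>c<t. (\<Sum>i<b. \<Sum>j<k. treat_ind d i j a * left_ind d i j c) =
       (\<Sum>i<b. \<Sum>j<k. left_ind d i j a * treat_ind d i j c)) \<longrightarrow> Z = 0\<^sub>m (b * k) t"
proof -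
  define A where "A = hcat (treat_mat t b k d) (left_mat t b k d)"
  define Y where "Y = centered_total_mat t b k d"
  define W where "W = mat b t (\<lambda>(i, a). 2 * block_count k d i a / real k)"
  have A: "A \<in> carrier_mat (b * k) (2 * t)"
    using hcat_carrier[of "treat_mat t b k d" "b * k" t "left_mat t b k d" t]
    by (simp add: A_def treat_mat_def left_mat_def mult_2)
  have B: "block_mat b k \<in> carrier_mat (b * k) b" by (simp add: block_mat_def)
  have K: "K_mat t \<in> carrier_mat (2 * t) t" by (simp add: K_mat_def)
  have Y: "Y \<in> carrier_mat (b * k) t" by (simp add: Y_def centered_total_mat_def)
  have W: "W \<in> carrier_mat b t" by (simp add: W_def)
  have div: "r div k < b" "r mod k < k" if "r < b * k" for r
    using that k by (simp_all add: less_mult_imp_div_less)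
  have A_index: "A $$ (r, a) = treat_ind d (r div k) (r mod k) a"
    "A $$ (r, t + a) = left_ind d (r div k) (r mod k) a" if "r < b * k" "a < t" for r a
    using that by (simp_all add: A_def hcat_def treat_mat_def left_mat_def treat_ind_def left_ind_def)
  have AK: "A * K_mat t = Y + block_mat b k * W"
  proof (rule eq_matI)
    fix r a assume "r < dim_row (Y + block_mat b k * W)" "a < dim_col (Y + block_mat b k * W)"
    then have ra: "r < b * k" "a < t" using W B by auto
    have "(A * K_mat t) $$ (r, a) = (\<Sum>s<2 * t. A $$ (r, s) * (if s mod t = a then 1 else 0))"
      using ra A by (simp add: K_mat_def scalar_prod_def atLeast0LessThan)
    also have "\<dots> = treat_ind d (r div k) (r mod k) a + left_ind d (r div k) (r mod k) a"
      using ra by (simp add: sum_mult_mod_eq A_index)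
    also have "\<dots> = Y $$ (r, a) + W $$ (r div k, a)"
      using ra div by (simp add: Y_def centered_total_mat_def centered_total_def W_def)
    also have "W $$ (r div k, a) = (block_mat b k * W) $$ (r, a)"
      using ra div W by (simp add: block_mat_def scalar_prod_def if_distrib[of "\<lambda>x. x * _"] cong: if_cong)
    finally show "(A * K_mat t) $$ (r, a) = (Y + block_mat b k * W) $$ (r, a)"
      using ra W B by simp
  qed (use A B W K Y in auto)
  have BY: "transpose_mat (block_mat b k) * Y = 0\<^sub>m b t"
  proof (rule eq_matI)
    fix i a assume "i < dim_row (0\<^sub>m b t :: real mat)" "a < dim_col (0\<^sub>m b t :: real mat)"
    then have ia: "i < b" "a < t" by simp_all
    have "(transpose_mat (block_mat b k) * Y) $$ (i, a) =
      (\<Sum>r<b * k. (if r div k = i then 1 else 0) * centered_total k d (r div k) (r mod k) a)"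
      using ia by (simp add: block_mat_def Y_def centered_total_mat_def scalar_prod_def atLeast0LessThan)
    also have "\<dots> = (\<Sum>i'<b. \<Sum>j<k. (if i' = i then 1 else 0) * centered_total k d i' j a)"
      by (rule sum_div_mod)
    also have "\<dots> = 0" by (intro sum.neutral) (simp add: sum_centered_total_block)
    finally show "(transpose_mat (block_mat b k) * Y) $$ (i, a) = 0\<^sub>m b t $$ (i, a)" using ia by simp
  qed (use B Y in auto)
  \<comment> \<open>The matrix \<open>?G\<close> is T'Y, and \<open>K_mat t\<close> stacks it twice,
    so the real content is L'Y = T'Y.\<close>
  have AY: "transpose_mat A * Y = K_mat t * mat t t (\<lambda>(a, c). \<Sum>i<b. \<Sum>j<k. treat_ind d i j a * centered_total k d i j c)"
    (is "_ = _ * ?G")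
    if sym: "\<forall>a<t. \<forall>c<t. (\<Sum>i<b. \<Sum>j<k. treat_ind d i j a * left_ind d i j c) =
       (\<Sum>i<b. \<Sum>j<k. left_ind d i j a * treat_ind d i j c)"
  proof (rule eq_matI)
    fix s c assume "s < dim_row (K_mat t * ?G)" "c < dim_col (K_mat t * ?G)"
    then have s: "s < 2 * t" "s mod t < t" and c: "c < t" by (auto simp: K_mat_def)
    have "(K_mat t * ?G) $$ (s, c) = ?G $$ (s mod t, c)"
      using s c by (simp add: K_mat_def scalar_prod_def if_distrib[of "\<lambda>x. x * _"] cong: if_cong)
    also have "\<dots> = (\<Sum>i<b. \<Sum>j<k. treat_ind d i j (s mod t) * centered_total k d i j c)"
      using s c by simp
    also have "\<dots> = (transpose_mat A * Y) $$ (s, c)"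
    proof (cases "s < t")
      case True
      have "(transpose_mat A * Y) $$ (s, c) =
        (\<Sum>r<b * k. treat_ind d (r div k) (r mod k) s * centered_total k d (r div k) (r mod k) c)"
        using s c True A by (simp add: Y_def centered_total_mat_def scalar_prod_def atLeast0LessThan A_index)
      then show ?thesis using True by (simp add: sum_div_mod[of "\<lambda>i j. treat_ind d i j s * centered_total k d i j c"])
    next
      case False
      define a where "a = s - t"
      have a: "s = t + a" "a < t" "s mod t = a" using False s by (auto simp: a_def le_mod_geq)
      have "(transpose_mat A * Y) $$ (s, c) =
        (\<Sum>r<b * k. left_ind d (r div k) (r mod k) a * centered_total k d (r div k) (r mod k) c)"
        using s c a A by (simp add: Y_def centered_total_mat_def scalar_prod_def atLeast0LessThan A_index)
      also have "\<dots> = (\<Sum>i<b. \<Sum>j<k. left_ind d i j a * centered_total k d i j c)"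
        by (rule sum_div_mod)
      \<comment> \<open>The cyclic shift gives L'L = T'T, equal block totals make the centring terms
        agree, and the assumed symmetry exchanges L'T and T'L.\<close>
      also have "\<dots> = (\<Sum>i<b. \<Sum>j<k. treat_ind d i j a * centered_total k d i j c)"
      proof -
        have "(\<Sum>j<k. left_ind d i j a * left_ind d i j c) = (\<Sum>j<k. treat_ind d i j a * treat_ind d i j c)"
          if "i < b" for i
          using sum_cyclic_shift[of "\<lambda>j. left_ind d i j a * left_ind d i j c" k] design_borders[OF that]
          by (simp add: treat_ind_eq_left_ind) (simp add: left_ind_def)
        moreover have "(\<Sum>j<k. left_ind d i j a * x / y) = (\<Sum>j<k. treat_ind d i j a * x / y)"
          if "i < b" for i x y
          using that by (simp add: sum_distrib_right[symmetric] sum_divide_distrib[symmetric] sum_left_ind block_count_def)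
        ultimately show ?thesis
          using sym a(2) c
          by (simp add: centered_total_def right_diff_distrib distrib_left sum.distrib sum_subtractf)
      qed
      finally show ?thesis by (simp add: a)
    qed
    finally show "(transpose_mat A * Y) $$ (s, c) = (K_mat t * ?G) $$ (s, c)" ..
  qed (use A Y K in auto)
  obtain Z R where ZR: "Z \<in> carrier_mat (b * k) t" "R \<in> carrier_mat t (b * k)"
    "info_total t b k d = R * Y"
    "info_total t b k d = (1 / 2\<^sup>2) \<cdot>\<^sub>m (transpose_mat Y * Y - transpose_mat Z * Z)"
    "nnd_sym t (info_total t b k d)"
    and Z0: "\<And>G. G \<in> carrier_mat t t \<Longrightarrow> transpose_mat A * Y = K_mat t * G \<Longrightarrow> Z = 0\<^sub>m (b * k) t"
    using info_mat_lin_decomposition[OF A B K K_mat_gram _ Y W AK BY]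
    by (auto simp: info_total_def A_def)
  show thesis
  proof (rule that[OF ZR(1,2)])
    show "(\<forall>a<t. \<forall>c<t. (\<Sum>i<b. \<Sum>j<k. treat_ind d i j a * left_ind d i j c) =
       (\<Sum>i<b. \<Sum>j<k. left_ind d i j a * treat_ind d i j c)) \<longrightarrow> Z = 0\<^sub>m (b * k) t"
      using Z0[OF mat_carrier AY] by blast
  qed (use ZR in \<open>simp_all add: Y_def\<close>)
qed

text \<open>The information matrix has the centred totals as right factor, and these sum to 0 over
  the treatments.\<close>

lemma info_total_row_sum:
  assumes "a < t"
  shows "(\<Sum>c<t. info_total t b k d $$ (a, c)) = 0"
proof -
  obtain R where R: "R \<in> carrier_mat t (b * k)" "info_total t b k d = R * centered_total_mat t b k d"
    using info_total_decomposition by blast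
  have "(\<Sum>c<t. info_total t b k d $$ (a, c)) =
    (\<Sum>c<t. \<Sum>r<b * k. R $$ (a, r) * centered_total k d (r div k) (r mod k) c)"
    using R assms by (simp add: centered_total_mat_def scalar_prod_def atLeast0LessThan)
  also have "\<dots> = (\<Sum>r<b * k. R $$ (a, r) * (\<Sum>c<t. centered_total k d (r div k) (r mod k) c))"
    by (subst sum.swap) (simp add: sum_distrib_left)
  also have "\<dots> = 0"
    using k by (intro sum.neutral) (simp add: sum_centered_total_treatments less_mult_imp_div_less)
  finally show ?thesis .
qed

text \<open>Without self neighbours the entries of T + L are 0 or 1, hence equal to their
  squares.\<close>

lemma centered_total_gram_diag:
  assumes nsn: "no_self_neighbor b k d" and a: "a < t"
  shows "(transpose_mat (centered_total_mat t b k d) * centered_total_mat t b k d) $$ (a, a) =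
    (\<Sum>i<b. 2 * block_count k d i a - 4 * (block_count k d i a)\<^sup>2 / real k)"
proof -
  have "(\<Sum>j<k. (treat_ind d i j a + left_ind d i j a) * (treat_ind d i j a + left_ind d i j a)) =
    2 * block_count k d i a" if "i < b" for i
  proof -
    have sq: "(treat_ind d i j a + left_ind d i j a) * (treat_ind d i j a + left_ind d i j a) =
      treat_ind d i j a + left_ind d i j a" if "j < k" for j
    proof -
      have "d (Suc i) (Suc j) \<noteq> d (Suc i) j"
        using nsn \<open>i < b\<close> that by (force simp: no_self_neighbor_def)
      then show ?thesis by (auto simp: treat_ind_def left_ind_def)
    qed
    have "(\<Sum>j<k. (treat_ind d i j a + left_ind d i j a) * (treat_ind d i j a + left_ind d i j a)) =
      (\<Sum>j<k. treat_ind d i j a + left_ind d i j a)"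
      by (intro sum.cong refl sq) simp
    then show ?thesis using that by (simp only: sum.distrib sum_left_ind block_count_def mult_2)
  qed
  then show ?thesis by (simp add: centered_total_gram[OF a a] power2_eq_square mult.assoc)
qed

text \<open>Four times the trace bound: each block has \<open>k\<close> plots and contributes
  \<open>2 * k - 4\<close>.\<close>

lemma sum_block_count_linear:
  "(\<Sum>a<t. \<Sum>i<b. 2 * block_count k d i a - 4 * block_count k d i a / real k) = 2 * real b * (real k - 2)"
proof -
  have "(\<Sum>a<t. \<Sum>i<b. 2 * block_count k d i a - 4 * block_count k d i a / real k) =
    (\<Sum>i<b. 2 * (\<Sum>a<t. block_count k d i a) - 4 * (\<Sum>a<t. block_count k d i a) / real k)"
    by (subst sum.swap) (simp add: sum_subtractf sum_distrib_left sum_divide_distrib)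
  then show ?thesis using k by (simp add: sum_block_count algebra_simps)
qed

lemma info_total_trace_le:
  assumes nsn: "no_self_neighbor b k d"
  shows "(\<Sum>a<t. info_total t b k d $$ (a, a)) \<le> real b * (real k - 2) / 2"
proof -
  let ?Y = "centered_total_mat t b k d"
  obtain Z where Z: "Z \<in> carrier_mat (b * k) t"
    and info: "info_total t b k d = (1 / 4) \<cdot>\<^sub>m (transpose_mat ?Y * ?Y - transpose_mat Z * Z)"
    using info_total_decomposition by blast
  have "info_total t b k d $$ (a, a) \<le> 1 / 4 * (\<Sum>i<b. 2 * block_count k d i a - 4 * block_count k d i a / real k)"
    if "a < t" for a
  proof -
    \<comment> \<open>Of the loss term only the nonnegative diagonal matters.\<close>
    have "0 \<le> (transpose_mat Z * Z) $$ (a, a)"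
      using Z that by (simp add: scalar_prod_def sum_nonneg)
    moreover have "info_total t b k d $$ (a, a) =
      1 / 4 * ((transpose_mat ?Y * ?Y) $$ (a, a) - (transpose_mat Z * Z) $$ (a, a))"
      using that Z unfolding info by (simp add: centered_total_mat_def)
    ultimately have "info_total t b k d $$ (a, a) \<le> 1 / 4 * (transpose_mat ?Y * ?Y) $$ (a, a)" by simp
    also have "(transpose_mat ?Y * ?Y) $$ (a, a) =
      (\<Sum>i<b. 2 * block_count k d i a - 4 * (block_count k d i a)\<^sup>2 / real k)"
      by (rule centered_total_gram_diag[OF nsn that])
    also have "\<dots> \<le> (\<Sum>i<b. 2 * block_count k d i a - 4 * block_count k d i a / real k)"
    proof (rule sum_mono)
      fix i
      \<comment> \<open>Integrality of the replication is what yields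
        \<open>n \<le> n * n\<close>.\<close>
      obtain n :: nat where n: "block_count k d i a = real n"
        by (rule that[of "\<Sum>j<k. of_bool (d (Suc i) (Suc j) = Suc a)"]) (simp add: block_count_def treat_ind_def)
      have "n * 1 \<le> n * n" by (cases n) auto
      then have "block_count k d i a \<le> (block_count k d i a)\<^sup>2"
        unfolding n power2_eq_square by (metis mult.right_neutral of_nat_le_iff of_nat_mult)
      then show "2 * block_count k d i a - 4 * (block_count k d i a)\<^sup>2 / real k
        \<le> 2 * block_count k d i a - 4 * block_count k d i a / real k"
        by (simp add: divide_right_mono)
    qed
    finally show ?thesis by simp
  qed
  then have "(\<Sum>a<t. info_total t b k d $$ (a, a)) \<le>
    (\<Sum>a<t. 1 / 4 * (\<Sum>i<b. 2 * block_count k d i a - 4 * block_count k d i a / real k))"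
    by (intro sum_mono) auto
  also have "\<dots> = real b * (real k - 2) / 2"
    by (simp only: sum_distrib_left[symmetric] sum_block_count_linear)
  finally show ?thesis .
qed

end

section \<open>The information matrix of a circular neighbor-balanced design\<close>

lemma binary_block_count:
  assumes "binary_design b k d" "i < b"
  shows "block_count k d i a = of_bool (Suc a \<in> d (Suc i) ` {1..k})"
proof (cases "Suc a \<in> d (Suc i) ` {1..k}")
  case True
  then obtain m where m: "m \<in> {1..k}" "Suc a = d (Suc i) m" by (rule imageE)
  have "treat_ind d i j a = (if j = m - 1 then 1 else 0)" if "j < k" for j
  proof -
    have "d (Suc i) (Suc j) = d (Suc i) m \<longleftrightarrow> Suc j = m"
      using assms(1)[unfolded binary_design_def, rule_format, of "Suc i" "Suc j" m] assms(2) m(1) that by auto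
    then show ?thesis unfolding treat_ind_def m(2) using m(1) by auto
  qed
  then have "block_count k d i a = (\<Sum>j<k. if j = m - 1 then 1 else 0)"
    unfolding block_count_def by (intro sum.cong) simp_all
  also have "\<dots> = 1"
  proof -
    have "m - 1 < k" using m(1) unfolding atLeastAtMost_iff by arith
    then show ?thesis by simp
  qed
  finally show ?thesis using True by (simp only: of_bool_eq)
next
  case False
  have "treat_ind d i j a = 0" if "j < k" for j
  proof -
    have "d (Suc i) (Suc j) \<in> d (Suc i) ` {1..k}" using that by (intro imageI) simp
    then have "d (Suc i) (Suc j) \<noteq> Suc a" using False by metis
    then show ?thesis by (simp add: treat_ind_def)
  qed
  then show ?thesis using False by (simp add: block_count_def)
qed

text \<open>Binarity separates inner plots. The first plot has plot \<open>k\<close> as its left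
  neighbour by circularity, which is a different plot because \<open>2 \<le> k\<close>.\<close>

lemma CNBD_no_self_neighbor:
  assumes cnbd: "CNBD t b k l d" and k: "2 \<le> k"
  shows "no_self_neighbor b k d"
  unfolding no_self_neighbor_def
proof (intro ballI)
  fix i j assume ij: "i \<in> {1..b}" "j \<in> {1..k}"
  have inj: "j1 = j2" if "j1 \<in> {1..k}" "j2 \<in> {1..k}" "d i j1 = d i j2" for j1 j2
  proof -
    have "binary_design b k d" using cnbd by (simp add: CNBD_def)
    then show ?thesis using ij that unfolding binary_design_def by blast
  qed
  have border: "d i 0 = d i k" using cnbd ij by (simp add: CNBD_def circular_design_def)
  show "d i j \<noteq> d i (j - 1)"
  proof (cases "j = 1")
    case True
    then show ?thesis using inj[of 1 k] border ij k by auto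
  next
    case False
    then have "j - 1 \<in> {1..k}" "j \<noteq> j - 1" using ij unfolding atLeastAtMost_iff by arith+
    then show ?thesis using inj[of j "j - 1"] ij by blast
  qed
qed

text \<open>Balance is used only to make the diagonal and the off-diagonal entries constant; their
  values then follow from the trace and the zero row sums.\<close>

lemma CNBD_info_total:
  assumes cnbd: "CNBD t b k l d" and k: "2 \<le> k" and t: "2 \<le> t"
  shows "info_total t b k d = (real b * (real k - 2) / (2 * (real t - 1))) \<cdot>\<^sub>m centering_mat t"
proof -
  have circ: "circular_design t b k d" and bin: "binary_design b k d"
    and bal: "balanced_block_design t b k d" using cnbd by (auto simp: CNBD_def)
  have k0: "0 < k" using k by simp
  note nsn = CNBD_no_self_neighbor[OF cnbd k]
  let ?Y = "centered_total_mat t b k d"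
  \<comment> \<open>The entries of T'L: plots with treatment \<open>a\<close> whose left neighbour
    has \<open>c\<close>.\<close>
  define N where "N a c = (\<Sum>i<b. \<Sum>j<k. treat_ind d i j a * left_ind d i j c)" for a c
  have N: "N a c = real l" if "a < t" "c < t" "a \<noteq> c" for a c
  proof -
    \<comment> \<open>Neighbour balance looks to the right, from \<open>c\<close> to
      \<open>a\<close>; a cyclic shift turns this into the left-neighbour count.\<close>
    have "card {(i, j). i \<in> {1..b} \<and> j \<in> {1..k} \<and> d i j = Suc c \<and> d i (j + 1) = Suc a} = l"
      using cnbd that by (simp add: CNBD_def)
    then have "real l = (\<Sum>i<b. \<Sum>j<k. left_ind d i (Suc j) c * treat_ind d i (Suc j) a)"
      using real_card_plots[of b k "\<lambda>i j. d i j = Suc c \<and> d i (j + 1) = Suc a"]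
      by (simp add: left_ind_def treat_ind_def of_bool_conj)
    also have "\<dots> = (\<Sum>i<b. \<Sum>j<k. left_ind d i j c * treat_ind d i j a)"
    proof (rule sum.cong[OF refl])
      fix i assume "i \<in> {..<b}"
      then show "(\<Sum>j<k. left_ind d i (Suc j) c * treat_ind d i (Suc j) a) = (\<Sum>j<k. left_ind d i j c * treat_ind d i j a)"
        using sum_cyclic_shift[of "\<lambda>j. left_ind d i j c * treat_ind d i j a" k] design_borders[OF circ k0, of i]
        by (simp add: left_ind_def treat_ind_def)
    qed
    finally show ?thesis by (simp add: N_def mult.commute)
  qed
  have N_sym: "N a c = (\<Sum>i<b. \<Sum>j<k. left_ind d i j a * treat_ind d i j c)" if "a < t" "c < t" for a c
  proof -
    have "N a c = N c a" using N that by (cases "a = c") auto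
    then show ?thesis by (simp add: N_def mult.commute)
  qed
  obtain Z R where "Z \<in> carrier_mat (b * k) t" "R \<in> carrier_mat t (b * k)"
    "info_total t b k d = R * ?Y"
    and Z: "info_total t b k d = (1 / 4) \<cdot>\<^sub>m (transpose_mat ?Y * ?Y - transpose_mat Z * Z)"
    and nnd: "nnd_sym t (info_total t b k d)"
    and Z0: "(\<forall>a<t. \<forall>c<t. (\<Sum>i<b. \<Sum>j<k. treat_ind d i j a * left_ind d i j c) =
       (\<Sum>i<b. \<Sum>j<k. left_ind d i j a * treat_ind d i j c)) \<longrightarrow> Z = 0\<^sub>m (b * k) t"
    by (rule info_total_decomposition[OF circ k0])
  have "Z = 0\<^sub>m (b * k) t" by (rule Z0[rule_format]) (rule N_sym[unfolded N_def])
  then have info: "info_total t b k d $$ (a, c) = (transpose_mat ?Y * ?Y) $$ (a, c) / 4"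
    if "a < t" "c < t" for a c using that Z by (simp add: centered_total_mat_def del: index_mult_mat(1))
  from bal obtain r where "\<forall>a\<in>{1..t}. card {(i, j). i \<in> {1..b} \<and> j \<in> {1..k} \<and> d i j = a} = r"
    unfolding balanced_block_design_def by blast
  then have r: "card {(i, j). i \<in> {1..b} \<and> j \<in> {1..k} \<and> d i j = Suc a} = r" if "a < t" for a
    using that by simp
  from bal obtain \<mu> where "\<forall>a\<in>{1..t}. \<forall>c\<in>{1..t}. a \<noteq> c \<longrightarrow>
      card {i \<in> {1..b}. a \<in> d i ` {1..k} \<and> c \<in> d i ` {1..k}} = \<mu>"
    unfolding balanced_block_design_def by blast
  then have \<mu>: "card {i \<in> {1..b}. Suc a \<in> d i ` {1..k} \<and> Suc c \<in> d i ` {1..k}} = \<mu>"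
    if "a < t" "c < t" "a \<noteq> c" for a c
    using that by simp
  define \<tau> where "\<tau> = real b * (real k - 2) / 2"
  have diag_eq: "info_total t b k d $$ (a, a) =
      1 / 4 * (\<Sum>i<b. 2 * block_count k d i a - 4 * block_count k d i a / real k)" if "a < t" for a
  proof -
    \<comment> \<open>Replications 0 or 1: the trace bound becomes an equality.\<close>
    have "(block_count k d i a)\<^sup>2 = block_count k d i a" if "i < b" for i
      using that by (simp add: binary_block_count[OF bin])
    then show ?thesis using that by (simp add: info centered_total_gram_diag[OF circ k0 nsn])
  qed
  have trace: "(\<Sum>a<t. info_total t b k d $$ (a, a)) = \<tau>"
  proof -
    have "(\<Sum>a<t. info_total t b k d $$ (a, a)) =
      (\<Sum>a<t. 1 / 4 * (\<Sum>i<b. 2 * block_count k d i a - 4 * block_count k d i a / real k))"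
      by (intro sum.cong refl diag_eq) simp
    then show ?thesis
      by (simp only: sum_distrib_left[symmetric] sum_block_count_linear[OF circ k0] \<tau>_def)
  qed
  have diag_const: "info_total t b k d $$ (a, a) = 1 / 4 * (2 * real r - 4 * real r / real k)" if "a < t" for a
  proof -
    have "real (card {(i, j). i \<in> {1..b} \<and> j \<in> {1..k} \<and> d i j = Suc a}) = (\<Sum>i<b. block_count k d i a)"
      unfolding block_count_def treat_ind_def by (rule real_card_plots)
    then have count: "(\<Sum>i<b. block_count k d i a) = real r" by (simp only: r[OF that])
    have "info_total t b k d $$ (a, a) =
      1 / 4 * (2 * (\<Sum>i<b. block_count k d i a) - 4 * (\<Sum>i<b. block_count k d i a) / real k)"
      unfolding diag_eq[OF that] by (simp only: sum_subtractf sum_distrib_left sum_divide_distrib)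
    then show ?thesis by (simp only: count)
  qed
  have diag: "info_total t b k d $$ (a, a) = \<tau> / real t" if "a < t" for a
  proof -
    have "(\<Sum>c<t. info_total t b k d $$ (c, c)) = (\<Sum>c<t. info_total t b k d $$ (a, a))"
      by (intro sum.cong refl) (simp only: diag_const that lessThan_iff)
    then have "\<tau> = real t * info_total t b k d $$ (a, a)" by (simp only: trace) simp
    then show ?thesis using t by simp
  qed
  have off_const: "info_total t b k d $$ (a, c) = (2 * real l - 4 * real \<mu> / real k) / 4"
    if ac: "a < t" "c < t" "a \<noteq> c" for a c
  proof -
    have "(\<Sum>i<b. block_count k d i a * block_count k d i c) =
      (\<Sum>i<b. of_bool (Suc a \<in> d (Suc i) ` {1..k} \<and> Suc c \<in> d (Suc i) ` {1..k}))"
      by (simp add: binary_block_count[OF bin] of_bool_conj)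
    also have "\<dots> = (\<Sum>i\<in>{1..b}. of_bool (Suc a \<in> d i ` {1..k} \<and> Suc c \<in> d i ` {1..k}))"
      by (simp add: sum.atLeast1_atMost_eq)
    also have "\<dots> = real \<mu>" using \<mu>[OF ac] by (simp add: Int_def)
    finally have \<mu>': "(\<Sum>i<b. block_count k d i a * block_count k d i c) = real \<mu>" .
    \<comment> \<open>A plot carries one treatment, so for \<open>a \<noteq> c\<close> only the
      mixed products remain.\<close>
    have "(\<Sum>i<b. \<Sum>j<k. (treat_ind d i j a + left_ind d i j a) * (treat_ind d i j c + left_ind d i j c)) =
      (\<Sum>i<b. \<Sum>j<k. treat_ind d i j a * left_ind d i j c + left_ind d i j a * treat_ind d i j c)"
      using ac by (intro sum.cong refl) (auto simp: treat_ind_def left_ind_def)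
    also have "\<dots> = N a c + N a c"
      using N_sym[OF ac(1,2)] by (simp add: N_def sum.distrib)
    also have "\<dots> = 2 * real l" by (simp add: N[OF ac])
    finally have l: "(\<Sum>i<b. \<Sum>j<k. (treat_ind d i j a + left_ind d i j a) * (treat_ind d i j c + left_ind d i j c)) =
      2 * real l" .
    have "info_total t b k d $$ (a, c) =
      ((\<Sum>i<b. \<Sum>j<k. (treat_ind d i j a + left_ind d i j a) * (treat_ind d i j c + left_ind d i j c)) -
       4 * (\<Sum>i<b. block_count k d i a * block_count k d i c) / real k) / 4"
      unfolding info[OF ac(1,2)] centered_total_gram[OF circ k0 ac(1,2)]
      by (simp only: sum_subtractf sum_distrib_left sum_divide_distrib mult.assoc)
    then show ?thesis by (simp only: l \<mu>')
  qed
  have off: "info_total t b k d $$ (a, c) = - \<tau> / (real t * (real t - 1))"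
    if ac: "a < t" "c < t" "a \<noteq> c" for a c
  proof -
    have "0 = info_total t b k d $$ (a, a) + (\<Sum>c\<in>{..<t} - {a}. info_total t b k d $$ (a, c))"
      using info_total_row_sum[OF circ k0 ac(1)] ac by (simp add: sum.remove)
    also have "(\<Sum>c\<in>{..<t} - {a}. info_total t b k d $$ (a, c)) =
      (\<Sum>c'\<in>{..<t} - {a}. info_total t b k d $$ (a, c))"
      using ac by (intro sum.cong) (auto simp: off_const)
    finally show ?thesis using ac t by (simp add: diag of_nat_diff field_simps)
  qed
  have coeff: "real b * (real k - 2) / (2 * (real t - 1)) = \<tau> / (real t - 1)" by (simp add: \<tau>_def)
  show ?thesis
    unfolding coeff
  proof (rule eq_matI)
    fix a c assume "a < dim_row ((\<tau> / (real t - 1)) \<cdot>\<^sub>m centering_mat t)"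
      "c < dim_col ((\<tau> / (real t - 1)) \<cdot>\<^sub>m centering_mat t)"
    then have ac: "a < t" "c < t" by (simp_all add: centering_mat_def)
    then show "info_total t b k d $$ (a, c) = ((\<tau> / (real t - 1)) \<cdot>\<^sub>m centering_mat t) $$ (a, c)"
      using t by (cases "a = c") (simp_all add: diag off centering_mat_def field_simps)
  qed (use nnd_symD[OF nnd] in \<open>auto simp: centering_mat_def\<close>)
qed

theorem theorem6:
  fixes t b k l :: nat and dstar :: "nat \<Rightarrow> nat \<Rightarrow> nat"
  assumes "0 < b" and "3 \<le> k" and "k \<le> t"
    and "t * (t - 1) dvd b * k"
    and "l = b * k div (t * (t - 1))"
    and "CNBD t b k l dstar"
  shows "universally_optimal t (info_total t b k)
           (\<lambda>d. circular_design t b k d \<and> no_self_neighbor b k d) dstar"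
  unfolding universally_optimal_def
proof (intro allI impI)
  fix \<Phi> d assume \<Phi>: "kiefer_criterion t \<Phi>" and d: "circular_design t b k d \<and> no_self_neighbor b k d"
  have kt: "0 < k" "2 \<le> k" "2 \<le> t" using assms by simp_all
  have nnd: "nnd_sym t (info_total t b k d)"
    using info_total_decomposition[of t b k d] d kt by blast
  show "\<Phi> (info_total t b k dstar) \<le> \<Phi> (info_total t b k d)"
    \<comment> \<open>The coefficient is the trace bound divided by \<open>t - 1\<close>, so the
      remaining trace condition is the bound for \<open>d\<close>.\<close>
    unfolding CNBD_info_total[OF assms(6) kt(2,3)]
  proof (rule kiefer_criterion_centering_le[OF \<Phi> nnd kt(3)])
    show "(\<Sum>c<t. info_total t b k d $$ (a, c)) = 0" if "a < t" for a
      using info_total_row_sum[of t b k d a] d kt that by simp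
    show "(\<Sum>a<t. info_total t b k d $$ (a, a)) \<le> (real t - 1) * (real b * (real k - 2) / (2 * (real t - 1)))"
    proof -
      have "(real t - 1) * (real b * (real k - 2) / (2 * (real t - 1))) = real b * (real k - 2) / 2"
        using kt by (simp add: divide_simps) (simp add: algebra_simps)
      then show ?thesis using info_total_trace_le[of t b k d] d kt by metis
    qed
  qed
qed

end
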